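(* Let $H$ be a separable Hilbert space, $\{H_i\}_{i\in I}$ a family of Hilbert spaces, $C,C'$ bounded invertible operators on $H$ with bounded inverses, and $\Lambda=\{\Lambda_i\in\mathcal B(H,H_i)\}_{i\in I}$ a family such that $P_i:=C^*\Lambda_i^*\Lambda_iC'$ is a positive operator on $H$ for each $i\in I$. Then $\Lambda$ is a $CC'$-controlled g-frame for $H$ if and only if $$T_{CC'}:K\to H,\qquad \{P_i^{1/2}f\}_{i\in I}\longmapsto\sum_{i\in I}C^*\Lambda_i^*\Lambda_iC'f$$ is a well-defined and surjective operator, where $K=\big\{\{P_i^{1/2}f\}_{i\in I}: f\in H\big\}$ is regarded as a subspace of $\ell^2(I,H)$.
   Context: $\mathcal B(H,K)$ denotes the bounded linear operators from $H$ to $K$. $\Lambda$ is a $CC'$-controlled g-frame for $H$ if there are constants $0<A\le B<\infty$ with $A\|f\|^2\le\sum_{i\in I}\langle \Lambda_iC'f,\Lambda_iCf\rangle\le B\|f\|^2$ for all $f\in H$ (the terms equal $\langle P_if,f\rangle\ge0$). $\ell^2(I,H)$ is the Hilbert space of families $\{g_i\}_{i\in I}$ in $H$ with $\sum_i\|g_i\|^2<\infty$. "Well-defined" means: for each $f\in H$ the family $\{P_i^{1/2}f\}_{i\in I}$ belongs to $\ell^2(I,H)$, the series $\sum_{i\in I}P_if$ converges unconditionally in $H$, and its sum depends only on the family $\{P_i^{1/2}f\}_{i\in I}$. Positive operators are self-adjoint and $P_i^{1/2}$ is the positive square root. *)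

theory Defs
  imports "HOL-Analysis.Analysis" "HOL-Algebra.Module"
begin

text \<open>
  Scalars: a class with instances \<open>real\<close> and \<open>complex\<close>, so that real and complex
  Hilbert spaces are covered at the same time.  The last axiom forces
  \<open>hconj x = \<bar>x\<bar>\<^sup>2 / x\<close> for nonzero \<open>x\<close>, so conjugation is determined by the norm.
\<close>

class hilbert_scalar = real_normed_field +
  fixes hconj :: "'a \<Rightarrow> 'a"
  assumes hconj_add: "hconj (x + y) = hconj x + hconj y"
    and hconj_mult: "hconj (x * y) = hconj x * hconj y"
    and hconj_hconj: "hconj (hconj x) = x"
    and hconj_scaleR_one: "hconj (r *\<^sub>R 1) = r *\<^sub>R 1"
    and mult_hconj: "x * hconj x = (norm x)\<^sup>2 *\<^sub>R 1"

instantiation real :: hilbert_scalar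
begin
definition hconj_real :: "real \<Rightarrow> real" where "hconj_real x = x"
instance by standard (simp_all add: hconj_real_def power2_eq_square)
end

instantiation complex :: hilbert_scalar
begin
definition hconj_complex :: "complex \<Rightarrow> complex" where "hconj_complex = cnj"
instance by standard (simp_all add: hconj_complex_def complex_norm_square[symmetric]
      scaleR_conv_of_real)
end

definition nonneg_scalar :: "'k::hilbert_scalar \<Rightarrow> bool"
  where "nonneg_scalar z \<longleftrightarrow> (\<exists>r\<ge>0. z = of_real r)"

text \<open>
  A Hilbert space filling a whole type: a Banach space over \<open>'k\<close> whose norm comes from a
  \<open>'k\<close>-valued inner product, linear in the first argument.  Completeness is part of the class
  \<open>banach\<close>.
\<close>

locale hilbert_space = vector_space scl
  for scl :: "'k::hilbert_scalar \<Rightarrow> 'h::banach \<Rightarrow> 'h" +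
  fixes ip :: "'h \<Rightarrow> 'h \<Rightarrow> 'k"
  assumes scale_of_real: "scl (of_real r) x = r *\<^sub>R x"
    and ip_add_left: "ip (x + y) z = ip x z + ip y z"
    and ip_scale_left: "ip (scl a x) z = a * ip x z"
    and ip_commute: "ip y x = hconj (ip x y)"
    and ip_self: "ip x x = of_real ((norm x)\<^sup>2)"

text \<open>
  The members of a family of Hilbert spaces \<open>H\<^sub>i\<close> cannot each have a type of their own.  They are
  structures whose carriers are subsets of one type \<open>'g\<close>, each with its own vector space
  operations and its own inner product.  The multiplicative fields inherited from the record
  \<open>module\<close> play no role.
\<close>

record ('k, 'g) inner_struct = "('k, 'g) module" +
  hinner :: "'g \<Rightarrow> 'g \<Rightarrow> 'k"

definition scalar_ring :: "'k::hilbert_scalar ring"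
  where "scalar_ring = \<lparr>carrier = UNIV, monoid.mult = (*), one = 1, ring.zero = 0, add = (+)\<rparr>"

definition hnorm :: "('k::hilbert_scalar, 'g) inner_struct \<Rightarrow> 'g \<Rightarrow> real"
  where "hnorm M x = sqrt (norm (hinner M x x))"

locale hilbert_struct = Module.module scalar_ring M
  for M :: "('k::hilbert_scalar, 'g) inner_struct" +
  assumes hinner_add_left: "\<lbrakk>x \<in> carrier M; y \<in> carrier M; z \<in> carrier M\<rbrakk>
      \<Longrightarrow> hinner M (x \<oplus>\<^bsub>M\<^esub> y) z = hinner M x z + hinner M y z"
    and hinner_smult_left: "\<lbrakk>x \<in> carrier M; z \<in> carrier M\<rbrakk>
      \<Longrightarrow> hinner M (a \<odot>\<^bsub>M\<^esub> x) z = a * hinner M x z"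
    and hinner_commute: "\<lbrakk>x \<in> carrier M; y \<in> carrier M\<rbrakk>
      \<Longrightarrow> hinner M y x = hconj (hinner M x y)"
    and hinner_nonneg: "x \<in> carrier M \<Longrightarrow> nonneg_scalar (hinner M x x)"
    and hinner_definite: "\<lbrakk>x \<in> carrier M; hinner M x x = 0\<rbrakk> \<Longrightarrow> x = \<zero>\<^bsub>M\<^esub>"
    and complete: "Metric_space.mcomplete (carrier M) (\<lambda>x y. hnorm M (x \<ominus>\<^bsub>M\<^esub> y))"

definition bounded_op :: "('k::hilbert_scalar \<Rightarrow> 'h::banach \<Rightarrow> 'h) \<Rightarrow> ('h \<Rightarrow> 'h) \<Rightarrow> bool"
  where "bounded_op scl T \<longleftrightarrow>
    Vector_Spaces.linear scl scl T \<and> (\<exists>c. \<forall>x. norm (T x) \<le> c * norm x)"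

definition bounded_op_into ::
  "('k::hilbert_scalar \<Rightarrow> 'h::banach \<Rightarrow> 'h) \<Rightarrow> ('k, 'g) inner_struct \<Rightarrow> ('h \<Rightarrow> 'g) \<Rightarrow> bool"
  where "bounded_op_into scl M T \<longleftrightarrow>
    (\<forall>x. T x \<in> carrier M) \<and>
    (\<forall>x y. T (x + y) = T x \<oplus>\<^bsub>M\<^esub> T y) \<and>
    (\<forall>a x. T (scl a x) = a \<odot>\<^bsub>M\<^esub> T x) \<and>
    (\<exists>c. \<forall>x. hnorm M (T x) \<le> c * norm x)"

definition boundedly_invertible ::
  "('k::hilbert_scalar \<Rightarrow> 'h::banach \<Rightarrow> 'h) \<Rightarrow> ('h \<Rightarrow> 'h) \<Rightarrow> bool"
  where "boundedly_invertible scl T \<longleftrightarrow>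
    bounded_op scl T \<and> (\<exists>S. bounded_op scl S \<and> S \<circ> T = id \<and> T \<circ> S = id)"

text \<open>
  Hilbert space adjoint of an operator whose domain is a whole type, given the inner products of
  its domain and of its codomain.  For a bounded operator and \<open>y\<close> in the codomain, the description
  is satisfied by exactly one vector (Riesz).
\<close>

definition hadjoint :: "('h \<Rightarrow> 'h \<Rightarrow> 'k) \<Rightarrow> ('g \<Rightarrow> 'g \<Rightarrow> 'k) \<Rightarrow> ('h \<Rightarrow> 'g) \<Rightarrow> 'g \<Rightarrow> 'h"
  where "hadjoint ip ip' T y = (THE x. \<forall>f. ip' (T f) y = ip f x)"

definition positive_op ::
  "('k::hilbert_scalar \<Rightarrow> 'h::banach \<Rightarrow> 'h) \<Rightarrow> ('h \<Rightarrow> 'h \<Rightarrow> 'k) \<Rightarrow> ('h \<Rightarrow> 'h) \<Rightarrow> bool"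
  where "positive_op scl ip T \<longleftrightarrow>
    bounded_op scl T \<and> hadjoint ip ip T = T \<and> (\<forall>f. nonneg_scalar (ip (T f) f))"

definition op_sqrt ::
  "('k::hilbert_scalar \<Rightarrow> 'h::banach \<Rightarrow> 'h) \<Rightarrow> ('h \<Rightarrow> 'h \<Rightarrow> 'k) \<Rightarrow> ('h \<Rightarrow> 'h) \<Rightarrow> 'h \<Rightarrow> 'h"
  where "op_sqrt scl ip T = (THE Q. positive_op scl ip Q \<and> Q \<circ> Q = T)"

text \<open>The operator \<open>P\<^sub>i = C\<^sup>* \<Lambda>\<^sub>i\<^sup>* \<Lambda>\<^sub>i C'\<close>.\<close>

definition controlled_op ::
  "('h \<Rightarrow> 'h \<Rightarrow> 'k) \<Rightarrow> ('i \<Rightarrow> ('k, 'g) inner_struct) \<Rightarrow> ('h \<Rightarrow> 'h) \<Rightarrow> ('h \<Rightarrow> 'h)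
    \<Rightarrow> ('i \<Rightarrow> 'h \<Rightarrow> 'g) \<Rightarrow> 'i \<Rightarrow> 'h \<Rightarrow> 'h"
  where "controlled_op ip Hs C C' \<Lambda> i =
    hadjoint ip ip C \<circ> hadjoint ip (hinner (Hs i)) (\<Lambda> i) \<circ> \<Lambda> i \<circ> C'"

text \<open>The series is \<open>'k\<close>-valued; its sum is required to be a real number \<open>s\<close> between the bounds.\<close>

definition controlled_g_frame ::
  "'i set \<Rightarrow> ('i \<Rightarrow> ('k::hilbert_scalar, 'g) inner_struct) \<Rightarrow> ('h::banach \<Rightarrow> 'h) \<Rightarrow> ('h \<Rightarrow> 'h)
    \<Rightarrow> ('i \<Rightarrow> 'h \<Rightarrow> 'g) \<Rightarrow> bool"
  where "controlled_g_frame I Hs C C' \<Lambda> \<longleftrightarrow>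
    (\<exists>A B. 0 < A \<and> A \<le> B \<and>
      (\<forall>f. \<exists>s::real. ((\<lambda>i. hinner (Hs i) (\<Lambda> i (C' f)) (\<Lambda> i (C f))) has_sum of_real s) I
        \<and> A * (norm f)\<^sup>2 \<le> s \<and> s \<le> B * (norm f)\<^sup>2))"

text \<open>Families indexed by \<open>I\<close> are functions that are \<open>undefined\<close> outside \<open>I\<close>.\<close>

definition ell2 :: "'i set \<Rightarrow> ('i \<Rightarrow> 'h::banach) set"
  where "ell2 I = {g \<in> extensional I. (\<lambda>i. (norm (g i))\<^sup>2) summable_on I}"

definition sqrt_family ::
  "('k::hilbert_scalar \<Rightarrow> 'h::banach \<Rightarrow> 'h) \<Rightarrow> ('h \<Rightarrow> 'h \<Rightarrow> 'k) \<Rightarrow> 'i set \<Rightarrow> ('i \<Rightarrow> 'h \<Rightarrow> 'h)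
    \<Rightarrow> 'h \<Rightarrow> 'i \<Rightarrow> 'h"
  where "sqrt_family scl ip I P f = (\<lambda>i\<in>I. op_sqrt scl ip (P i) f)"

definition sqrt_families ::
  "('k::hilbert_scalar \<Rightarrow> 'h::banach \<Rightarrow> 'h) \<Rightarrow> ('h \<Rightarrow> 'h \<Rightarrow> 'k) \<Rightarrow> 'i set \<Rightarrow> ('i \<Rightarrow> 'h \<Rightarrow> 'h)
    \<Rightarrow> ('i \<Rightarrow> 'h) set"
  where "sqrt_families scl ip I P = range (sqrt_family scl ip I P)"

text \<open>
  The prescription \<open>{P\<^sub>i\<^sup>1\<^sup>/\<^sup>2 f}\<^sub>i \<mapsto> \<Sum>\<^sub>i P\<^sub>i f\<close> is well-defined.  Summability over a set in the
  sense of \<open>summable_on\<close> is unconditional convergence.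
\<close>

definition synthesis_well_defined ::
  "('k::hilbert_scalar \<Rightarrow> 'h::banach \<Rightarrow> 'h) \<Rightarrow> ('h \<Rightarrow> 'h \<Rightarrow> 'k) \<Rightarrow> 'i set \<Rightarrow> ('i \<Rightarrow> 'h \<Rightarrow> 'h) \<Rightarrow> bool"
  where "synthesis_well_defined scl ip I P \<longleftrightarrow>
    (\<forall>f. sqrt_family scl ip I P f \<in> ell2 I) \<and>
    (\<forall>f. (\<lambda>i. P i f) summable_on I) \<and>
    (\<forall>f f'. sqrt_family scl ip I P f = sqrt_family scl ip I P f' \<longrightarrow>
      (\<Sum>\<^sub>\<infinity>i\<in>I. P i f) = (\<Sum>\<^sub>\<infinity>i\<in>I. P i f'))"

text \<open>
  The induced map: choose any \<open>f\<close> representing the given family.  The value does not depend on the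
  choice when the prescription is well-defined.
\<close>

definition synthesis ::
  "('k::hilbert_scalar \<Rightarrow> 'h::banach \<Rightarrow> 'h) \<Rightarrow> ('h \<Rightarrow> 'h \<Rightarrow> 'k) \<Rightarrow> 'i set \<Rightarrow> ('i \<Rightarrow> 'h \<Rightarrow> 'h)
    \<Rightarrow> ('i \<Rightarrow> 'h) \<Rightarrow> 'h"
  where "synthesis scl ip I P g =
    (\<Sum>\<^sub>\<infinity>i\<in>I. P i (SOME f. sqrt_family scl ip I P f = g))"

text \<open>Linearity on a set of families with respect to the pointwise operations of \<open>\<ell>\<^sup>2(I, H)\<close>.\<close>

definition linear_on_families ::
  "('k::hilbert_scalar \<Rightarrow> 'h::banach \<Rightarrow> 'h) \<Rightarrow> 'i set \<Rightarrow> ('i \<Rightarrow> 'h) set \<Rightarrow> (('i \<Rightarrow> 'h) \<Rightarrow> 'h) \<Rightarrow> bool"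
  where "linear_on_families scl I K T \<longleftrightarrow>
    (\<forall>g\<in>K. \<forall>h\<in>K. (\<lambda>i\<in>I. g i + h i) \<in> K \<and> T (\<lambda>i\<in>I. g i + h i) = T g + T h) \<and>
    (\<forall>a. \<forall>g\<in>K. (\<lambda>i\<in>I. scl a (g i)) \<in> K \<and> T (\<lambda>i\<in>I. scl a (g i)) = scl a (T g))"

end

theory Submission
  imports Defs
begin

text \<open>
  Since \<open>\<langle>\<Lambda>\<^sub>i C' f, \<Lambda>\<^sub>i C f\<rangle> = \<langle>P\<^sub>i f, f\<rangle> = \<parallel>P\<^sub>i\<^sup>1\<^sup>/\<^sup>2 f\<parallel>\<^sup>2\<close>, both sides are statements about
  \<open>S f = \<Sum>\<^sub>i P\<^sub>i f\<close>, and \<open>T\<close> sends \<open>{P\<^sub>i\<^sup>1\<^sup>/\<^sup>2 f}\<^sub>i\<close> to \<open>S f\<close>.  The upper frame bound controls the norms of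
  the finite partial sums by the Cauchy--Schwarz inequality for positive forms, so the series
  converges unconditionally; the lower bound makes \<open>S\<close> coercive, hence surjective.  Conversely, if
  the series converges for every \<open>f\<close>, then \<open>S\<close> is symmetric and everywhere defined, hence bounded by
  Hellinger--Toeplitz, which is the upper bound.  If \<open>S\<close> is surjective it is injective by symmetry,
  and its inverse is again symmetric and everywhere defined, hence bounded, which gives the lower
  bound.  The analysis takes place in the real Hilbert space with inner product \<open>Re \<langle>x, y\<rangle>\<close>.
\<close>

section \<open>Positive operators on a real Hilbert space\<close>

lemma quadratic_nonneg_imp_discriminant:
  fixes a b c :: real
  assumes "\<And>t. 0 \<le> a + 2 * t * b + t\<^sup>2 * c"
  shows "b\<^sup>2 \<le> a * c"
proof (cases "c = 0")
  case True
  show ?thesis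
  proof (cases "b = 0")
    case False
    \<comment> \<open>With \<open>c = 0\<close> the polynomial is affine in \<open>t\<close>, and
      this \<open>t\<close> gives it the value \<open>-1\<close>.\<close>
    then show ?thesis
      using assms[of "- (a + 1) / (2 * b)"] True by (simp add: field_simps)
  qed (use True in simp)
next
  case False
  have "0 \<le> c"
  proof (rule ccontr)
    assume "\<not> 0 \<le> c"
    \<comment> \<open>If \<open>c\<close> were negative, the polynomial would be negative for large
      \<open>t\<close>. This \<open>t\<close> is at least 1 and makes \<open>2 * b + t * c\<close>
      at most \<open>c - \<bar>a\<bar>\<close>.\<close>
    define t where "t = 1 + (\<bar>a\<bar> + 2 * \<bar>b\<bar>) / (- c)"
    have "t \<ge> 1" and tc: "t * c = c - (\<bar>a\<bar> + 2 * \<bar>b\<bar>)"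
      using \<open>\<not> 0 \<le> c\<close> by (auto simp: t_def field_simps)
    have "a + 2 * t * b + t\<^sup>2 * c = a + t * (2 * b + t * c)"
      by (simp add: power2_eq_square algebra_simps)
    also have "\<dots> \<le> a + t * (c - \<bar>a\<bar>)"
      using \<open>t \<ge> 1\<close> by (intro add_left_mono mult_left_mono) (auto simp: tc)
    also have "\<dots> \<le> a + 1 * (c - \<bar>a\<bar>)"
      using \<open>t \<ge> 1\<close> \<open>\<not> 0 \<le> c\<close> by (intro add_left_mono mult_right_mono_neg) auto
    also have "\<dots> < 0" using \<open>\<not> 0 \<le> c\<close> by auto
    finally show False using assms[of t] by simp
  qed
  then show ?thesis
    using assms[of "- b / c"] False by (simp add: field_simps power2_eq_square)
qed

text \<open>Evaluating the form at \<open>x + t *\<^sub>R y\<close> gives a nonnegative quadratic in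
  \<open>t\<close>. The form may be degenerate, as can happen in the later uses:
  \<open>ri (T x) y\<close> for positive \<open>T\<close>, and an inner product pulled back along an
  operator.\<close>

lemma psd_form_Cauchy_Schwarz:
  fixes b :: "'a::real_vector \<Rightarrow> 'a \<Rightarrow> real"
  assumes add: "\<And>x y z. b (x + y) z = b x z + b y z"
    and scale: "\<And>r x z. b (r *\<^sub>R x) z = r * b x z"
    and sym: "\<And>x y. b x y = b y x"
    and nonneg: "\<And>x. 0 \<le> b x x"
  shows "(b x y)\<^sup>2 \<le> b x x * b y y"
proof (rule quadratic_nonneg_imp_discriminant)
  fix t
  have "b (x + t *\<^sub>R y) (x + t *\<^sub>R y) = b x x + 2 * t * b x y + t\<^sup>2 * b y y"
    using sym[of x "x + t *\<^sub>R y"] sym[of y "x + t *\<^sub>R y"] sym[of x y]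
    by (simp add: add scale power2_eq_square algebra_simps)
  then show "0 \<le> b x x + 2 * t * b x y + t\<^sup>2 * b y y"
    using nonneg[of "x + t *\<^sub>R y"] by simp
qed

text \<open>By Baire, closed sets with empty interior have a countable union with empty interior,
  which cannot be the whole space. This serves the Hellinger--Toeplitz argument.\<close>

lemma closed_cover_has_interior:
  fixes E :: "nat \<Rightarrow> 'a::banach set"
  assumes "\<And>n. closed (E n)" and "(\<Union>n. E n) = UNIV"
  shows "\<exists>n. interior (E n) \<noteq> {}"
proof (rule ccontr)
  assume *: "\<nexists>n. interior (E n) \<noteq> {}"
  have "Met_TC.mtopology interior_of \<Union>(range E) = {}"
  proof (rule Met_TC.metric_Baire_category_alt)
    show "Met_TC.mcomplete (TYPE('a))"
      by (auto simp: Met_TC.mcomplete_def Cauchy_convergent_iff convergent_def)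
  qed (use assms(1) * in \<open>auto simp: interior_of_def interior_def\<close>)
  then show False using assms(2) by simp
qed

lemma summable_on_Cauchy_criterion:
  fixes f :: "'a \<Rightarrow> 'b::banach"
  assumes "\<And>e. 0 < e \<Longrightarrow>
    \<exists>F0. finite F0 \<and> F0 \<subseteq> A \<and> (\<forall>F. finite F \<and> F \<subseteq> A - F0 \<longrightarrow> norm (sum f F) < e)"
  shows "f summable_on A"
proof -
  have "\<exists>P. eventually P (finite_subsets_at_top A) \<and>
            (\<forall>F F'. P F \<and> P F' \<longrightarrow> dist (sum f F) (sum f F') < e)" if "e > 0" for e
  proof -
    obtain F0 where F0: "finite F0" "F0 \<subseteq> A"
      and *: "\<And>F. finite F \<Longrightarrow> F \<subseteq> A - F0 \<Longrightarrow> norm (sum f F) < e / 2"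
      using assms[of "e / 2"] \<open>e > 0\<close> by auto
    let ?P = "\<lambda>F. finite F \<and> F0 \<subseteq> F \<and> F \<subseteq> A"
    \<comment> \<open>All finite sets containing \<open>F0\<close> have sums within
      \<open>e / 2\<close> of the sum over \<open>F0\<close>, so any two such sums differ by less
      than \<open>e\<close>.\<close>
    have "dist (sum f F) (sum f F0) < e / 2" if "?P F" for F
      using that *[of "F - F0"] by (auto simp: dist_norm simp flip: sum_diff)
    then have "\<forall>F F'. ?P F \<and> ?P F' \<longrightarrow> dist (sum f F) (sum f F') < e"
      by (metis dist_triangle_half_l dist_commute)
    moreover have "eventually ?P (finite_subsets_at_top A)"
      unfolding eventually_finite_subsets_at_top using F0 by blast
    ultimately show ?thesis by blast
  qed
  then have "cauchy_filter (filtermap (sum f) (finite_subsets_at_top A))"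
    by (simp add: cauchy_filter_metric_filtermap)
  moreover have "complete (UNIV::'b set)"
    by (meson Cauchy_convergent UNIV_I complete_def convergent_def)
  ultimately obtain L' where "(sum f \<longlongrightarrow> L') (finite_subsets_at_top A)"
    using complete_uniform[where S=UNIV] by (force simp add: filterlim_def)
  then show ?thesis
    using summable_on_def has_sum_def by blast
qed

section \<open>Real Hilbert spaces and their positive operators\<close>

locale real_hilbert =
  fixes ri :: "'h::banach \<Rightarrow> 'h \<Rightarrow> real"
  assumes ri_add_left: "ri (x + y) z = ri x z + ri y z"
    and ri_scaleR_left: "ri (r *\<^sub>R x) z = r * ri x z"
    and ri_commute: "ri x y = ri y x"
    and ri_self: "ri x x = (norm x)\<^sup>2"
begin

lemma ri_Cauchy_Schwarz: "\<bar>ri x y\<bar> \<le> norm x * norm y"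
proof -
  have "(ri x y)\<^sup>2 \<le> (norm x * norm y)\<^sup>2"
    using psd_form_Cauchy_Schwarz[of ri x y, OF ri_add_left ri_scaleR_left ri_commute]
    by (simp add: ri_self power_mult_distrib)
  then show ?thesis by (metis abs_le_square_iff abs_norm_cancel abs_mult)
qed

lemma bounded_bilinear_ri: "bounded_bilinear ri"
proof
  show "\<exists>K. \<forall>a b. norm (ri a b) \<le> norm a * norm b * K"
    using ri_Cauchy_Schwarz by (intro exI[of _ 1]) auto
  show "ri a (b + b') = ri a b + ri a b'" for a b b'
    using ri_add_left[of b b' a] by (simp add: ri_commute)
  show "ri a (r *\<^sub>R b) = r *\<^sub>R ri a b" for a b r
    using ri_scaleR_left[of r b a] by (simp add: ri_commute)
qed (simp_all add: ri_add_left ri_scaleR_left)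

sublocale ri: bounded_bilinear ri by (rule bounded_bilinear_ri)

lemma ri_eq_zeroI: "(\<And>y. ri x y = 0) \<Longrightarrow> x = 0"
  using ri_self[of x] by simp

lemma ri_eqI: "(\<And>z. ri x z = ri y z) \<Longrightarrow> x = y"
  using ri_eq_zeroI[of "x - y"] by (simp add: ri.diff_left)

lemma norm_add_sq: "(norm (x + y))\<^sup>2 = (norm x)\<^sup>2 + 2 * ri x y + (norm y)\<^sup>2"
  by (simp add: ri_commute ri.add_left ri.add_right flip: ri_self)

lemma norm_diff_sq: "(norm (x - y))\<^sup>2 = (norm x)\<^sup>2 - 2 * ri x y + (norm y)\<^sup>2"
  by (simp add: ri_commute ri.diff_left ri.diff_right flip: ri_self)

text \<open>The representing vector minimises \<open>\<parallel>x\<parallel>\<^sup>2 / 2 - \<phi> x\<close>; minimising sequences are Cauchy by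
  the parallelogram law.\<close>

lemma riesz_representation:
  assumes "bounded_linear \<phi>"
  shows "\<exists>z. \<forall>x. \<phi> x = ri x z"
proof -
  interpret \<phi>: bounded_linear \<phi> by fact
  obtain k where k: "\<And>x. \<bar>\<phi> x\<bar> \<le> norm x * k"
    using \<phi>.bounded by auto
  define J where "J x = (norm x)\<^sup>2 / 2 - \<phi> x" for x
  have J_bdd: "- k\<^sup>2 / 2 \<le> J x" for x
  proof -
    have "\<phi> x \<le> norm x * k" using k[of x] by linarith
    moreover have "0 \<le> (norm x - k)\<^sup>2" by simp
    ultimately show ?thesis by (simp add: J_def power2_eq_square algebra_simps)
  qed
  define m where "m = Inf (range J)"
  have m_le: "m \<le> J x" for x
    unfolding m_def using J_bdd by (intro cInf_lower bdd_belowI2) auto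
  have "\<exists>x. J x < m + 1 / Suc n" for n
    using cInf_lessD[of "range J" "m + 1 / Suc n"] unfolding m_def by auto
  then obtain X where X: "\<And>n. J (X n) < m + 1 / Suc n" by metis
  have mid: "(norm (x - y))\<^sup>2 \<le> 4 * (J x + J y) - 8 * m" for x y
  proof -
    define u where "u = (1/2) *\<^sub>R (x + y)"
    have "(norm u)\<^sup>2 = (norm (x + y))\<^sup>2 / 4"
      by (simp add: u_def power_divide)
    moreover have "\<phi> u = (\<phi> x + \<phi> y) / 2" by (simp add: u_def \<phi>.scaleR \<phi>.add)
    ultimately have "J u = (J x + J y) / 2 - (norm (x - y))\<^sup>2 / 8"
      using norm_add_sq[of x y] norm_diff_sq[of x y] by (simp add: J_def field_simps)
    then show ?thesis using m_le[of u] by argo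
  qed
  have "Cauchy X"
  proof (rule metric_CauchyI)
    fix e :: real assume "0 < e"
    obtain N where N: "1 / Suc N < e\<^sup>2 / 8"
      using nat_approx_posE[of "e\<^sup>2 / 8"] \<open>0 < e\<close> by auto
    have *: "J (X n) < m + e\<^sup>2 / 8" if "n \<ge> N" for n
    proof -
      have "1 / real (Suc n) \<le> 1 / Suc N" using that by (intro divide_left_mono) auto
      then show ?thesis using X[of n] N by linarith
    qed
    show "\<exists>M. \<forall>i\<ge>M. \<forall>j\<ge>M. dist (X i) (X j) < e"
    proof (intro exI[of _ N] allI impI)
      fix i j assume "i \<ge> N" "j \<ge> N"
      then have "(norm (X i - X j))\<^sup>2 < e\<^sup>2"
        using mid[of "X i" "X j"] *[of i] *[of j] by argo
      then show "dist (X i) (X j) < e"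
        using \<open>0 < e\<close> by (simp add: dist_norm power2_less_imp_less)
    qed
  qed
  then obtain z where z: "X \<longlonglongrightarrow> z"
    using Cauchy_convergent convergent_def by blast
  have "(\<lambda>n. J (X n)) \<longlonglongrightarrow> J z"
    unfolding J_def by (intro tendsto_intros \<phi>.tendsto z) simp
  moreover have "(\<lambda>n. m + 1 / Suc n) \<longlonglongrightarrow> m + 0"
    by (intro tendsto_intros LIMSEQ_Suc[OF lim_1_over_n])
  ultimately have "J z \<le> m + 0"
    by (rule LIMSEQ_le) (use X less_imp_le in blast)
  have "\<phi> x = ri x z" for x
  proof -
    \<comment> \<open>Twice the increment of \<open>J\<close> from the minimiser \<open>z\<close> to
      \<open>z + t *\<^sub>R x\<close>. The constant term is 0, so the discriminant bound forces the
      linear coefficient to vanish.\<close>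
    have "0 \<le> 0 + 2 * t * (ri z x - \<phi> x) + t\<^sup>2 * (norm x)\<^sup>2" for t
    proof -
      have "J z \<le> J (z + t *\<^sub>R x)" using \<open>J z \<le> m + 0\<close> m_le[of "z + t *\<^sub>R x"] by linarith
      then show ?thesis
        unfolding J_def norm_add_sq
        by (simp add: \<phi>.add \<phi>.scaleR ri.scaleR_right power_mult_distrib field_simps)
    qed
    from quadratic_nonneg_imp_discriminant[OF this] show ?thesis
      by (simp add: ri_commute)
  qed
  then show ?thesis by blast
qed

definition positive :: "('h \<Rightarrow> 'h) \<Rightarrow> bool"
  where "positive T \<longleftrightarrow>
    bounded_linear T \<and> (\<forall>x y. ri (T x) y = ri x (T y)) \<and> (\<forall>x. 0 \<le> ri (T x) x)"

lemma positiveD: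
  assumes "positive T"
  shows "bounded_linear T" "ri (T x) y = ri x (T y)" "0 \<le> ri (T x) x"
  using assms unfolding positive_def by auto

lemma positive_Cauchy_Schwarz:
  assumes "positive T"
  shows "(ri (T x) y)\<^sup>2 \<le> ri (T x) x * ri (T y) y"
proof -
  interpret T: bounded_linear T using assms by (rule positiveD)
  show ?thesis
    by (rule psd_form_Cauchy_Schwarz[of "\<lambda>x y. ri (T x) y"])
      (simp_all add: T.add T.scaleR ri.add_left ri.scaleR_left positiveD(3)[OF assms],
        subst ri_commute, rule positiveD(2)[OF assms, symmetric])
qed

text \<open>Cauchy--Schwarz for the form of \<open>T\<close> at the pair \<open>x\<close>,
  \<open>T x\<close>, followed by cancelling \<open>(norm (T x))\<^sup>2\<close>. It converts a
  bound on the quadratic form into a bound on the norm.\<close>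

lemma positive_norm_sq_le:
  assumes "positive T" and "0 \<le> B" and "\<And>y. ri (T y) y \<le> B * (norm y)\<^sup>2"
  shows "(norm (T x))\<^sup>2 \<le> B * ri (T x) x"
proof (cases "T x = 0")
  case True
  then show ?thesis using assms(2) positiveD(3)[OF assms(1), of x] by (simp add: ri.zero_left)
next
  case False
  have "(norm (T x))\<^sup>2 * (norm (T x))\<^sup>2 = (ri (T x) (T x))\<^sup>2"
    by (simp add: ri_self power2_eq_square)
  also have "\<dots> \<le> ri (T x) x * ri (T (T x)) (T x)"
    by (rule positive_Cauchy_Schwarz[OF assms(1)])
  also have "\<dots> \<le> ri (T x) x * (B * (norm (T x))\<^sup>2)"
    using assms positiveD(3) by (intro mult_left_mono) auto
  finally have "(norm (T x))\<^sup>2 * (norm (T x))\<^sup>2 \<le> (B * ri (T x) x) * (norm (T x))\<^sup>2"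
    by (simp add: mult_ac)
  then show ?thesis by (rule mult_right_le_imp_le) (use False in simp)
qed

lemma positive_sum:
  assumes "\<And>i. i \<in> F \<Longrightarrow> positive (P i)"
  shows "positive (\<lambda>x. \<Sum>i\<in>F. P i x)"
  unfolding positive_def ri.sum_left ri.sum_right using positiveD[OF assms]
  by (intro conjI allI bounded_linear_sum sum_nonneg sum.cong) auto

lemma positive_eq_zeroI:
  assumes "positive T" and "ri (T x) x = 0"
  shows "T x = 0"
  using positive_Cauchy_Schwarz[OF assms(1), of x] assms(2) by (intro ri_eq_zeroI) simp

text \<open>Baire argument: the sets where \<open>norm (T x)\<close> is at most \<open>n\<close>
  cover the space, so one of them contains a ball, and linearity turns a bound on a ball into a
  global one.\<close>

lemma hellinger_toeplitz:
  assumes "linear T" and sym: "\<And>x y. ri (T x) y = ri x (T y)"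
  shows "bounded_linear T"
proof -
  interpret T: linear T by fact
  define E where "E n = {x. norm (T x) \<le> real n}" for n
  \<comment> \<open>Symmetry moves \<open>T\<close> onto \<open>y\<close>, so each condition is
    continuous in \<open>x\<close> before anything is known about continuity of \<open>T\<close>;
    this makes \<open>E n\<close> closed. The choice \<open>y = T x\<close> recovers the norm
    bound.\<close>
  have E_eq: "E n = (\<Inter>y. {x. ri x (T y) \<le> real n * norm y})" for n
  proof (intro equalityI subsetI)
    fix x assume "x \<in> E n"
    then have "ri (T x) y \<le> real n * norm y" for y
      using ri_Cauchy_Schwarz[of "T x" y] mult_right_mono[of "norm (T x)" "real n" "norm y"]
      by (auto simp: E_def)
    then show "x \<in> (\<Inter>y. {x. ri x (T y) \<le> real n * norm y})" by (simp add: sym)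
  next
    fix x assume "x \<in> (\<Inter>y. {x. ri x (T y) \<le> real n * norm y})"
    then have "ri (T x) (T x) \<le> real n * norm (T x)" by (simp add: sym)
    then show "x \<in> E n"
      by (cases "T x = 0") (auto simp: E_def ri_self power2_eq_square)
  qed
  have "\<exists>n. interior (E n) \<noteq> {}"
  proof (rule closed_cover_has_interior)
    show "closed (E n)" for n
      unfolding E_eq by (intro closed_INT ballI closed_Collect_le continuous_intros
          ri.continuous_on)
    show "(\<Union>n. E n) = UNIV"
      using real_arch_simple by (auto simp: E_def)
  qed
  then obtain n x0 e where "e > 0" and ball: "cball x0 e \<subseteq> E n"
    by (metis all_not_in_conv mem_interior_cball)
  have "norm (T x) \<le> norm x * (2 * real n / e)" for x
  proof (cases "x = 0")
    case False
    \<comment> \<open>\<open>x\<close> is rescaled to the radius of the ball; \<open>T u\<close> is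
      then a difference of two values of norm at most \<open>n\<close>.\<close>
    define u where "u = (e / norm x) *\<^sub>R x"
    have "norm u = e" using False \<open>e > 0\<close> by (simp add: u_def)
    then have "x0 + u \<in> E n" "x0 \<in> E n" using ball \<open>e > 0\<close> by (auto simp: dist_norm)
    then have "norm (T (x0 + u) - T x0) \<le> 2 * real n"
      using norm_triangle_ineq4[of "T (x0 + u)" "T x0"] by (simp add: E_def)
    then have "e / norm x * norm (T x) \<le> 2 * real n"
      using \<open>e > 0\<close> by (simp add: T.add u_def T.scale)
    then show ?thesis using False \<open>e > 0\<close> by (simp add: field_simps)
  qed (simp add: T.zero)
  then show ?thesis
    by (intro bounded_linear_intro[of T "2 * real n / e"]) (simp_all add: T.add T.scale)
qed

text \<open>As for Lax--Milgram: for suitable \<open>t > 0\<close> the map sending \<open>x\<close>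
  to \<open>x - t *\<^sub>R (T x - y)\<close> is a contraction, and its fixed point solves
  \<open>T x = y\<close>.\<close>

lemma coercive_surj:
  assumes "bounded_linear T" and "0 < A" and coer: "\<And>x. A * (norm x)\<^sup>2 \<le> ri (T x) x"
  shows "surj T"
proof -
  interpret T: bounded_linear T by fact
  obtain k where k0: "k > 0" and k: "\<And>x. norm (T x) \<le> norm x * k"
    using T.pos_bounded by auto
  \<comment> \<open>Adding \<open>A\<close> to the norm bound ensures \<open>A \<le> M\<close>,
    hence \<open>0 \<le> q\<close> below.\<close>
  define M where "M = k + A"
  have "M > 0" "A \<le> M" using k0 \<open>0 < A\<close> by (auto simp: M_def)
  have M: "norm (T x) \<le> M * norm x" for x
  proof -
    have "norm x * k \<le> M * norm x" using \<open>0 < A\<close> by (simp add: M_def algebra_simps)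
    then show ?thesis using k[of x] by linarith
  qed
  \<comment> \<open>This \<open>t\<close> minimises
    \<open>1 - 2 * t * A + t\<^sup>2 * M\<^sup>2\<close>, and \<open>q\<close> is the
    minimum.\<close>
  define t where "t = A / M\<^sup>2"
  have "t > 0" using \<open>0 < A\<close> \<open>M > 0\<close> by (simp add: t_def)
  define q where "q = 1 - A\<^sup>2 / M\<^sup>2"
  have "q < 1" using \<open>0 < A\<close> \<open>M > 0\<close> by (simp add: q_def)
  have "A\<^sup>2 \<le> M\<^sup>2" using \<open>0 < A\<close> \<open>A \<le> M\<close> by (intro power_mono) auto
  then have "0 \<le> q" using \<open>M > 0\<close> by (simp add: q_def)
  have contr: "norm (x - t *\<^sub>R T x) \<le> sqrt q * norm x" for x
  proof -
    have "(norm (T x))\<^sup>2 \<le> (M * norm x)\<^sup>2" using M by (intro power_mono) auto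
    then have 1: "t\<^sup>2 * (norm (T x))\<^sup>2 \<le> t\<^sup>2 * (M\<^sup>2 * (norm x)\<^sup>2)"
      by (intro mult_left_mono) (auto simp: power_mult_distrib)
    have 2: "2 * t * (A * (norm x)\<^sup>2) \<le> 2 * t * ri (T x) x"
      using coer \<open>t > 0\<close> by (intro mult_left_mono) auto
    have "(norm (x - t *\<^sub>R T x))\<^sup>2 = (norm x)\<^sup>2 - 2 * t * ri (T x) x + t\<^sup>2 * (norm (T x))\<^sup>2"
      unfolding norm_diff_sq by (simp add: ri.scaleR_right ri_commute power_mult_distrib)
    also have "\<dots> \<le> (norm x)\<^sup>2 - 2 * t * (A * (norm x)\<^sup>2) + t\<^sup>2 * (M\<^sup>2 * (norm x)\<^sup>2)"
      using 1 2 by linarith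
    also have "\<dots> = q * (norm x)\<^sup>2"
      using \<open>M > 0\<close> by (simp add: q_def t_def power2_eq_square field_simps)
    also have "\<dots> = (sqrt q * norm x)\<^sup>2" using \<open>0 \<le> q\<close> by (simp add: power_mult_distrib)
    finally show ?thesis by (rule power2_le_imp_le) (use \<open>0 \<le> q\<close> in simp)
  qed
  have "\<exists>x. T x = y" for y
  proof -
    define g where "g x = (x - t *\<^sub>R T x) + t *\<^sub>R y" for x
    have "dist (g x) (g x') \<le> sqrt q * dist x x'" for x x'
      using contr[of "x - x'"] by (simp add: g_def dist_norm T.diff algebra_simps)
    then have "\<exists>!x. g x = x"
      using \<open>0 \<le> q\<close> \<open>q < 1\<close> by (intro banach_fix_type[of "sqrt q"]) auto
    then obtain x where "g x = x" by blast
    then have "t *\<^sub>R (y - T x) = 0" by (simp add: g_def algebra_simps)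
    then show ?thesis using \<open>t > 0\<close> by auto
  qed
  then show ?thesis by (metis surj_def)
qed

text \<open>The kernel is orthogonal to the range, which is everything, so \<open>T\<close> is
  bijective. Its inverse inherits symmetry and is bounded by Hellinger--Toeplitz.\<close>

lemma positive_surj_imp_coercive:
  assumes "positive T" and "surj T"
  shows "\<exists>A>0. \<forall>x. A * (norm x)\<^sup>2 \<le> ri (T x) x"
proof -
  interpret T: bounded_linear T using assms(1) by (rule positiveD)
  note sym = positiveD(2)[OF assms(1)]
  have ker: "x = 0" if "T x = 0" for x
  proof (rule ri_eq_zeroI)
    fix y
    obtain w where "y = T w" using assms(2) by (meson surjD)
    then show "ri x y = 0" using sym[of x w] that by (simp add: ri.zero_left)
  qed
  have "inj T"
  proof (rule injI)
    fix x y assume "T x = T y"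
    then show "x = y" using ker[of "x - y"] by (simp add: T.diff)
  qed
  obtain R where TR: "T (R x) = x" for x
    using assms(2) by (metis surjD)
  have RT: "R (T x) = x" for x
    by (rule injD[OF \<open>inj T\<close>]) (simp add: TR)
  have "linear R"
    by (rule linearI; rule injD[OF \<open>inj T\<close>]) (simp_all add: TR T.add T.scaleR)
  moreover have "ri (R x) y = ri x (R y)" for x y
    using sym[of "R x" "R y"] by (simp add: TR)
  ultimately have "bounded_linear R" by (rule hellinger_toeplitz)
  then obtain k where "k > 0" and k: "\<And>x. norm (R x) \<le> norm x * k"
    using bounded_linear.pos_bounded by blast
  obtain c where "c > 0" and c: "\<And>x. norm (T x) \<le> norm x * c"
    using T.pos_bounded by blast
  have c2: "ri (T x) x \<le> c * (norm x)\<^sup>2" for x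
    using ri_Cauchy_Schwarz[of "T x" x] mult_right_mono[OF c[of x], of "norm x"]
    by (simp add: power2_eq_square mult_ac)
  \<comment> \<open>Combines \<open>norm x \<le> k * norm (T x)\<close>, from the inverse, with
    \<open>(norm (T x))\<^sup>2 \<le> c * ri (T x) x\<close>.\<close>
  have "1 / (c * k\<^sup>2) * (norm x)\<^sup>2 \<le> ri (T x) x" for x
  proof -
    have "(norm x)\<^sup>2 \<le> (norm (T x) * k)\<^sup>2" using k[of "T x"] by (simp add: RT power_mono)
    also have "\<dots> \<le> k\<^sup>2 * (c * ri (T x) x)"
      using positive_norm_sq_le[OF assms(1) _ c2] \<open>c > 0\<close>
      by (simp add: power_mult_distrib mult_left_mono mult.commute[of _ "k\<^sup>2"])
    finally show ?thesis using \<open>c > 0\<close> \<open>k > 0\<close> by (simp add: field_simps)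
  qed
  then show ?thesis using \<open>c > 0\<close> \<open>k > 0\<close> by (intro exI[of _ "1 / (c * k\<^sup>2)"]) auto
qed

text \<open>Each finite block is a positive operator with form bound \<open>B\<close>, so the
  squared norm of its value at \<open>f\<close> is at most \<open>B\<close> times the same block of
  the scalar series, which is small away from a finite set.\<close>

lemma positive_series_summable:
  assumes pos: "\<And>i. i \<in> I \<Longrightarrow> positive (P i)" and "0 \<le> B"
    and bdd: "\<And>F f. finite F \<Longrightarrow> F \<subseteq> I \<Longrightarrow> (\<Sum>i\<in>F. ri (P i f) f) \<le> B * (norm f)\<^sup>2"
    and sm: "(\<lambda>i. ri (P i f) f) summable_on I"
  shows "(\<lambda>i. P i f) summable_on I"
proof (rule summable_on_Cauchy_criterion)
  fix e :: real assume "0 < e"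
  \<comment> \<open>The denominator \<open>B + 1\<close> is positive even for \<open>B = 0\<close>,
    and \<open>B * d / 2\<close> stays below \<open>e\<^sup>2\<close>.\<close>
  define d where "d = e\<^sup>2 / (B + 1)"
  have "d > 0" using \<open>0 < e\<close> \<open>0 \<le> B\<close> by (simp add: d_def)
  let ?s = "infsum (\<lambda>i. ri (P i f) f) I"
  obtain F0 where F0: "finite F0" "F0 \<subseteq> I"
    and near: "dist (\<Sum>i\<in>F0. ri (P i f) f) ?s \<le> d / 2"
    using infsum_finite_approximation[OF sm, of "d / 2"] \<open>d > 0\<close> by auto
  show "\<exists>F0. finite F0 \<and> F0 \<subseteq> I \<and> (\<forall>F. finite F \<and> F \<subseteq> I - F0 \<longrightarrow> norm (\<Sum>i\<in>F. P i f) < e)"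
  proof (intro exI[of _ F0] conjI allI impI F0)
    fix F assume F: "finite F \<and> F \<subseteq> I - F0"
    have "(\<Sum>i\<in>F0 \<union> F. ri (P i f) f) \<le> ?s"
      using F F0 positiveD(3) pos by (intro finite_sum_le_infsum sm) auto
    moreover have "(\<Sum>i\<in>F0 \<union> F. ri (P i f) f) = (\<Sum>i\<in>F0. ri (P i f) f) + (\<Sum>i\<in>F. ri (P i f) f)"
      using F F0 by (intro sum.union_disjoint) auto
    ultimately have s: "(\<Sum>i\<in>F. ri (P i f) f) \<le> d / 2" using near by (simp only: dist_real_def)
    have "(norm (\<Sum>i\<in>F. P i f))\<^sup>2 \<le> B * ri (\<Sum>i\<in>F. P i f) f"
      using F pos \<open>0 \<le> B\<close> bdd
      by (intro positive_norm_sq_le positive_sum) (auto simp: ri.sum_left)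
    also have "\<dots> \<le> B * (d / 2)"
      using s \<open>0 \<le> B\<close> by (intro mult_left_mono) (auto simp: ri.sum_left)
    also have "\<dots> < e\<^sup>2"
    proof -
      have "B * d \<le> (B + 1) * d" using \<open>d > 0\<close> by (intro mult_right_mono) auto
      also have "\<dots> = e\<^sup>2" using \<open>0 \<le> B\<close> by (simp add: d_def)
      finally have "B * d / 2 \<le> e\<^sup>2 / 2" by simp
      also have "\<dots> < e\<^sup>2" using \<open>0 < e\<close> by simp
      finally show ?thesis by simp
    qed
    finally show "norm (\<Sum>i\<in>F. P i f) < e" using \<open>0 < e\<close> by (simp add: power2_less_imp_less)
  qed
qed

end

section \<open>Square roots of positive operators\<close>

text \<open>The coefficients \<open>d\<^sub>n\<close> of \<open>(1 - sqrt (1 - z)) / z\<close>.\<close>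

fun sqrt_coeff :: "nat \<Rightarrow> real" where
  "sqrt_coeff 0 = 1/2"
| "sqrt_coeff (Suc n) = (\<Sum>k\<le>n. sqrt_coeff k * sqrt_coeff (n - k)) / 2"

lemma sqrt_coeff_nonneg: "0 \<le> sqrt_coeff n"
proof (induction n rule: less_induct)
  case (less n)
  then show ?case by (cases n) (auto intro!: sum_nonneg mult_nonneg_nonneg)
qed

text \<open>The recursion bounds the next partial sum by \<open>1/2 + s\<^sup>2 / 2\<close>, where
  \<open>s\<close> is the current one: the index triangle \<open>i + j < N\<close> lies in the
  square, and all terms are nonnegative.\<close>

lemma sum_sqrt_coeff_le: "(\<Sum>n<N. sqrt_coeff n) \<le> 1"
proof (induction N)
  case (Suc N)
  let ?d = sqrt_coeff
  have "(\<Sum>n<N. \<Sum>k\<le>n. ?d k * ?d (n - k)) = (\<Sum>(i, j)\<in>{(i, j). i + j < N}. ?d i * ?d j)"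
    by (rule sum.triangle_reindex[symmetric])
  also have "\<dots> \<le> (\<Sum>(i, j)\<in>{..<N} \<times> {..<N}. ?d i * ?d j)"
    by (intro sum_mono2) (auto simp: sqrt_coeff_nonneg)
  also have "\<dots> = (\<Sum>n<N. ?d n) * (\<Sum>n<N. ?d n)"
    by (simp add: sum_product sum.cartesian_product)
  also have "\<dots> \<le> 1"
    using Suc by (intro mult_le_one sum_nonneg) (auto simp: sqrt_coeff_nonneg)
  finally show ?case
    unfolding sum.lessThan_Suc_shift by (simp flip: sum_divide_distrib)
qed simp

lemma sqrt_coeff_has_sum: "(sqrt_coeff has_sum infsum sqrt_coeff UNIV) UNIV"
  and infsum_sqrt_coeff_le: "infsum sqrt_coeff UNIV \<le> 1"
proof -
  have "summable sqrt_coeff"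
    by (rule summableI_nonneg_bounded[of _ 1]) (auto simp: sqrt_coeff_nonneg sum_sqrt_coeff_le)
  then have "sqrt_coeff summable_on UNIV"
    by (intro norm_summable_imp_summable_on) (simp add: sqrt_coeff_nonneg)
  then show *: "(sqrt_coeff has_sum infsum sqrt_coeff UNIV) UNIV" by simp
  show "infsum sqrt_coeff UNIV \<le> 1"
    using sum_sqrt_coeff_le by (intro LIMSEQ_le_const2[OF has_sum_imp_sums[OF *, unfolded sums_def]]) auto
qed

text \<open>With \<open>R = \<Sum>\<^sub>n d\<^sub>n A\<^sup>n\<close>, the operator \<open>1 - A R\<close> is a square root of \<open>1 - A\<close>.\<close>

locale nonexpansive_op =
  fixes A :: "'h::banach \<Rightarrow> 'h"
  assumes bounded_linear_A: "bounded_linear A"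
    and nonexpansive: "norm (A x) \<le> norm x"
begin

sublocale A: bounded_linear A by (rule bounded_linear_A)

definition R :: "'h \<Rightarrow> 'h"
  where "R x = (\<Sum>\<^sub>\<infinity>n. sqrt_coeff n *\<^sub>R (A ^^ n) x)"

lemma power_nonexpansive: "norm ((A ^^ n) x) \<le> norm x"
  by (induction n) (use nonexpansive order_trans in auto)

lemma bounded_linear_power: "bounded_linear (A ^^ n)"
proof (induction n)
  case (Suc n)
  then show ?case using bounded_linear_compose[OF bounded_linear_A Suc] by (simp add: comp_def)
qed (simp add: id_def bounded_linear_ident)

text \<open>Powers of \<open>A\<close> are nonexpansive, so the series is dominated by
  \<open>sqrt_coeff n * norm x\<close>, whose total is at most \<open>norm x\<close>.\<close>

lemma R_has_sum: "((\<lambda>n. sqrt_coeff n *\<^sub>R (A ^^ n) x) has_sum R x) UNIV"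
  and R_nonexpansive: "norm (R x) \<le> norm x"
proof -
  let ?f = "\<lambda>n. sqrt_coeff n *\<^sub>R (A ^^ n) x"
  have d: "((\<lambda>n. sqrt_coeff n * norm x) has_sum infsum sqrt_coeff UNIV * norm x) UNIV"
    by (rule has_sum_cmult_left[OF sqrt_coeff_has_sum])
  have le: "norm (?f n) \<le> sqrt_coeff n * norm x" for n
    by (simp add: sqrt_coeff_nonneg power_nonexpansive mult_left_mono)
  have abs: "?f abs_summable_on UNIV"
    by (rule summable_on_comparison_test[OF has_sum_imp_summable[OF d]]) (use le in auto)
  show f: "(?f has_sum R x) UNIV"
    unfolding R_def by (rule has_sum_infsum[OF abs_summable_summable[OF abs]])
  have "norm (R x) \<le> infsum (\<lambda>n. norm (?f n)) UNIV"
    by (rule norm_has_sum_bound[OF has_sum_infsum[OF abs] f])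
  also have "\<dots> \<le> infsum sqrt_coeff UNIV * norm x"
    by (rule has_sum_mono[OF has_sum_infsum[OF abs] d le])
  also have "\<dots> \<le> norm x"
    using mult_right_mono[OF infsum_sqrt_coeff_le, of "norm x"] by simp
  finally show "norm (R x) \<le> norm x" .
qed

text \<open>\<open>B\<close> commutes with every power of \<open>A\<close> and passes through the
  convergent sum. Taking \<open>B\<close> to be a real scaling gives homogeneity of
  \<open>R\<close>; taking \<open>B = A\<close> gives \<open>A R = R A\<close>.\<close>

lemma R_commute:
  assumes "bounded_linear B" and comm: "\<And>x. B (A x) = A (B x)"
  shows "B (R x) = R (B x)"
proof -
  interpret B: bounded_linear B by fact
  have "B ((A ^^ n) x) = (A ^^ n) (B x)" for n
    by (induction n) (simp_all add: comm)
  then have "((\<lambda>n. sqrt_coeff n *\<^sub>R (A ^^ n) (B x)) has_sum B (R x)) UNIV"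
    using has_sum_bounded_linear[OF assms(1) R_has_sum[of x]] by (simp add: B.scaleR)
  then show ?thesis using R_has_sum has_sum_unique by blast
qed

lemma bounded_linear_R: "bounded_linear R"
proof (rule bounded_linear_intro)
  show "R (x + y) = R x + R y" for x y
    using has_sum_add[OF R_has_sum[of x] R_has_sum[of y]] R_has_sum[of "x + y"] has_sum_unique
    by (fastforce simp: bounded_linear.linear[OF bounded_linear_power, THEN linear_add]
        simp flip: scaleR_add_right)
  show "R (r *\<^sub>R x) = r *\<^sub>R R x" for r x
    using R_commute[of "\<lambda>x. r *\<^sub>R x" x] by (simp add: bounded_linear_scaleR_right A.scaleR)
  show "norm (R x) \<le> norm x * 1" for x
    using R_nonexpansive by simp
qed

text \<open>The operator form of \<open>z * D\<^sup>2 = 2 * D - 1\<close> for the generating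
  function \<open>D\<close> of the coefficients. The double series \<open>f\<close> is summed by
  rows, giving \<open>R (R x)\<close>, and along antidiagonals, where the recursion yields
  \<open>2 * ?d (Suc k)\<close>.\<close>

lemma R_equation: "A (R (R x)) = 2 *\<^sub>R R x - x"
proof -
  let ?d = sqrt_coeff
  define f where "f = (\<lambda>(i, j). (?d i * ?d j) *\<^sub>R (A ^^ (i + j)) x)"
  have "(\<lambda>p. ?d (fst p) * ?d (snd p)) summable_on UNIV \<times> UNIV"
    using has_sum_imp_summable[OF has_sum_cmult_left[OF sqrt_coeff_has_sum]]
    by (intro summable_on_SigmaI) (auto intro!: has_sum_cmult_right sqrt_coeff_has_sum
        simp: sqrt_coeff_nonneg)
  then have "(\<lambda>p. ?d (fst p) * ?d (snd p) * norm x) summable_on UNIV \<times> UNIV"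
    by (rule summable_on_cmult_left)
  then have "f abs_summable_on UNIV \<times> UNIV"
    by (rule summable_on_comparison_test)
      (auto simp: f_def sqrt_coeff_nonneg power_nonexpansive mult_left_mono)
  then have "f summable_on UNIV \<times> UNIV" by (rule abs_summable_summable)
  then obtain s where s: "(f has_sum s) (UNIV \<times> UNIV)" by (auto simp: summable_on_def)
  have inner: "((\<lambda>j. f (i, j)) has_sum ?d i *\<^sub>R (A ^^ i) (R x)) UNIV" for i
  proof -
    have "bounded_linear (\<lambda>y. ?d i *\<^sub>R (A ^^ i) y)"
      by (intro bounded_linear_scaleR_right[THEN bounded_linear_compose] bounded_linear_power)
    from has_sum_bounded_linear[OF this R_has_sum[of x]] show ?thesis
      by (simp add: f_def funpow_add bounded_linear.linear[OF bounded_linear_power, THEN linear_scale])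
  qed
  have "((\<lambda>i. ?d i *\<^sub>R (A ^^ i) (R x)) has_sum s) UNIV"
    by (rule has_sum_SigmaD[OF s inner])
  then have "s = R (R x)" using R_has_sum has_sum_unique by blast
  have "bij_betw (\<lambda>(k, i). (i, k - i)) (SIGMA k:UNIV. {..k}) (UNIV \<times> (UNIV :: nat set))"
    by (rule bij_betwI[where g = "\<lambda>(i, j). (i + j, i)"]) auto
  from s[folded has_sum_reindex_bij_betw[OF this, of f]]
  have "((\<lambda>(k, i). (?d i * ?d (k - i)) *\<^sub>R (A ^^ k) x) has_sum s) (SIGMA k:UNIV. {..k})"
    by (rule has_sum_cong[THEN iffD1, rotated]) (auto simp: f_def)
  then have "((\<lambda>k. \<Sum>i\<le>k. (?d i * ?d (k - i)) *\<^sub>R (A ^^ k) x) has_sum s) UNIV"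
    by (rule has_sum_SigmaD) (simp add: has_sum_finite)
  then have "((\<lambda>k. (2 * ?d (Suc k)) *\<^sub>R (A ^^ k) x) has_sum s) UNIV"
    by (simp flip: scaleR_sum_left)
  from has_sum_imp_sums[OF has_sum_bounded_linear[OF bounded_linear_A this]]
  have "(\<lambda>k. 2 *\<^sub>R (?d (Suc k) *\<^sub>R (A ^^ Suc k) x)) sums A s"
    by (simp add: A.scaleR del: sqrt_coeff.simps)
  \<comment> \<open>Applying \<open>A\<close> has shifted the series by one, so only the term
    \<open>n = 0\<close> of \<open>R x\<close> is missing; since \<open>?d 0 = 1/2\<close>, doubling
    turns it into \<open>x\<close>.\<close>
  moreover have "(\<lambda>k. ?d (Suc k) *\<^sub>R (A ^^ Suc k) x) sums (R x - ?d 0 *\<^sub>R (A ^^ 0) x)"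
    using has_sum_imp_sums[OF R_has_sum[of x]] sums_Suc_iff[of "\<lambda>k. ?d k *\<^sub>R (A ^^ k) x"] by simp
  from sums_scaleR_right[OF this, of 2]
  have "(\<lambda>k. 2 *\<^sub>R (?d (Suc k) *\<^sub>R (A ^^ Suc k) x)) sums (2 *\<^sub>R R x - x)"
    by (simp add: scaleR_diff_right del: sqrt_coeff.simps(2))
  ultimately show ?thesis using sums_unique2 \<open>s = R (R x)\<close> by blast
qed

lemma sqrt_one_minus: "(x - A (R x)) - A (R (x - A (R x))) = x - A x"
proof -
  interpret R: bounded_linear R by (rule bounded_linear_R)
  have "R (A (R x)) = 2 *\<^sub>R R x - x"
    using R_commute[OF bounded_linear_A, of "R x"] by (simp add: R_equation)
  then show ?thesis by (simp add: R.diff A.diff A.scaleR scaleR_2)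
qed

end

section \<open>Existence and uniqueness of positive square roots; sums of positive operators\<close>

context real_hilbert
begin

text \<open>With \<open>c\<close> a norm bound for \<open>P\<close>, the operator
  \<open>A = 1 - P / c\<close> lies between 0 and 1, so it is nonexpansive and
  \<open>Q = sqrt c * (1 - A R)\<close> squares to \<open>P\<close>. \<open>Q\<close> is positive
  because \<open>A R\<close> is symmetric and nonexpansive. The commutation clause is used for
  uniqueness and for linearity over the full scalar field.\<close>

lemma positive_sqrt_exists:
  assumes "positive P"
  shows "\<exists>Q. positive Q \<and> (\<forall>x. Q (Q x) = P x) \<and>
    (\<forall>B. bounded_linear B \<and> (\<forall>x. B (P x) = P (B x)) \<longrightarrow> (\<forall>x. B (Q x) = Q (B x)))"
proof -
  note sym = positiveD(2)[OF assms] and nonneg = positiveD(3)[OF assms]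
  interpret P: bounded_linear P using assms by (rule positiveD)
  obtain c where "c > 0" and c: "\<And>x. norm (P x) \<le> norm x * c"
    using P.pos_bounded by blast
  define A where "A x = x - (1 / c) *\<^sub>R P x" for x
  have bl: "bounded_linear A"
    unfolding A_def by (intro bounded_linear_sub bounded_linear_ident P.bounded_linear_axioms
        bounded_linear_scaleR_right[THEN bounded_linear_compose])
  have Ax: "ri (A x) y = ri x y - ri (P x) y / c" for x y
    by (simp add: A_def ri.diff_left ri.scaleR_left)
  have xA: "ri x (A y) = ri x y - ri x (P y) / c" for x y
    by (simp add: A_def ri.diff_right ri.scaleR_right)
  have "ri (P x) x \<le> c * (norm x)\<^sup>2" for x
    using ri_Cauchy_Schwarz[of "P x" x] mult_right_mono[OF c[of x], of "norm x"]
    by (simp add: power2_eq_square mult_ac)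
  then have "positive A"
    using bl \<open>c > 0\<close> by (auto simp: positive_def Ax xA ri_self sym field_simps)
  then have "(norm (A x))\<^sup>2 \<le> 1 * ri (A x) x" for x
    using nonneg \<open>c > 0\<close> by (intro positive_norm_sq_le) (auto simp: Ax ri_self)
  also have "1 * ri (A x) x \<le> (norm x)\<^sup>2" for x
    using nonneg \<open>c > 0\<close> by (simp add: Ax ri_self)
  finally have nA: "norm (A x) \<le> norm x" for x
    by (rule power2_le_imp_le) simp
  interpret nonexpansive_op A by (rule nonexpansive_op.intro[OF bl nA])
  interpret R: bounded_linear R by (rule bounded_linear_R)
  have symA: "ri (A x) y = ri x (A y)" for x y using positiveD(2)[OF \<open>positive A\<close>] .
  have symR: "ri (R x) y = ri x (R y)" for x y
  proof -
    have "ri ((A ^^ n) x) y = ri x ((A ^^ n) y)" for n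
      by (induction n arbitrary: x y) (simp_all add: symA funpow_swap1)
    then have "((\<lambda>n. ri x (sqrt_coeff n *\<^sub>R (A ^^ n) y)) has_sum ri (R x) y) UNIV"
      using has_sum_bounded_linear[OF ri.bounded_linear_left R_has_sum[of x], of y]
      by (simp add: ri.scaleR_left ri.scaleR_right)
    then show ?thesis
      using has_sum_bounded_linear[OF ri.bounded_linear_right R_has_sum[of y], of x]
        has_sum_unique by blast
  qed
  have AR: "A (R x) = R (A x)" for x using R_commute[OF bl] by metis
  define Q where "Q x = sqrt c *\<^sub>R (x - A (R x))" for x
  have blQ: "bounded_linear Q"
    unfolding Q_def by (intro bounded_linear_scaleR_right[THEN bounded_linear_compose]
        bounded_linear_sub bounded_linear_ident bounded_linear_compose[OF bl bounded_linear_R])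
  have "positive Q"
    unfolding positive_def
  proof (intro conjI allI blQ)
    show "ri (Q x) y = ri x (Q y)" for x y
      by (simp add: Q_def ri.scaleR_left ri.scaleR_right ri.diff_left ri.diff_right symA symR)
        (simp flip: AR add: symA symR)
    fix x
    have "\<bar>ri (A (R x)) x\<bar> \<le> norm (A (R x)) * norm x" by (rule ri_Cauchy_Schwarz)
    also have "\<dots> \<le> norm x * norm x"
      by (intro mult_right_mono order_trans[OF nA R_nonexpansive] norm_ge_zero)
    finally have "ri (A (R x)) x \<le> (norm x)\<^sup>2" by (simp add: power2_eq_square)
    then show "0 \<le> ri (Q x) x"
      using \<open>c > 0\<close> by (simp add: Q_def ri.scaleR_left ri.diff_left ri_self)
  qed
  moreover have "Q (Q x) = P x" for x
  proof -
    interpret Q: bounded_linear Q by (rule blQ)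
    have "Q (Q x) = sqrt c *\<^sub>R Q (x - A (R x))" unfolding Q_def[of x] by (rule Q.scaleR)
    also have "\<dots> = c *\<^sub>R (x - A x)"
      using \<open>c > 0\<close> unfolding Q_def sqrt_one_minus by simp
    also have "\<dots> = P x" using \<open>c > 0\<close> by (simp add: A_def)
    finally show ?thesis .
  qed
  moreover have "B (Q x) = Q (B x)" if "bounded_linear B" "\<And>x. B (P x) = P (B x)" for B x
  proof -
    interpret B: bounded_linear B by fact
    have BA: "B (A x) = A (B x)" for x by (simp add: A_def B.diff B.scaleR that)
    show ?thesis by (simp add: Q_def B.diff B.scaleR BA R_commute[OF that(1) BA])
  qed
  ultimately show ?thesis by blast
qed

text \<open>Any positive root \<open>Q\<close> commutes with \<open>P = Q Q\<close>, hence with the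
  constructed root \<open>R\<close>. On \<open>y = Q x - R x\<close> the operator
  \<open>Q + R\<close> vanishes, so both nonnegative forms vanish at \<open>y\<close>, which gives
  \<open>Q y = R y = 0\<close> and then \<open>ri y y = 0\<close>.\<close>

lemma positive_sqrt_unique:
  assumes "positive P"
  shows "\<exists>!Q. positive Q \<and> (\<forall>x. Q (Q x) = P x)"
proof -
  obtain R where R: "positive R" "\<And>x. R (R x) = P x"
    and comm: "\<And>B x. bounded_linear B \<Longrightarrow> (\<And>x. B (P x) = P (B x)) \<Longrightarrow> B (R x) = R (B x)"
    using positive_sqrt_exists[OF assms] by metis
  show ?thesis
  proof (rule ex1I[of _ R])
    fix Q assume Q: "positive Q \<and> (\<forall>x. Q (Q x) = P x)"
    interpret Q: bounded_linear Q using Q positiveD(1) by blast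
    interpret R: bounded_linear R using R(1) by (rule positiveD)
    have QQ: "Q (Q x) = P x" for x using Q by blast
    have QR: "Q (R x) = R (Q x)" for x
      by (rule comm) (simp_all add: Q.bounded_linear_axioms flip: QQ)
    have "Q x = R x" for x
    proof -
      define y where "y = Q x - R x"
      have "Q y + R y = 0" by (simp add: y_def Q.diff R.diff QQ R(2) QR)
      then have "ri (Q y) y + ri (R y) y = 0" by (simp add: ri.zero_left flip: ri.add_left)
      then have "ri (Q y) y = 0" "ri (R y) y = 0"
        using positiveD(3)[of Q y] positiveD(3)[of R y] Q R(1) by auto
      then have "Q y = 0" "R y = 0" using positive_eq_zeroI Q R(1) by auto
      then have "ri y y = 0"
        using positiveD(2)[of Q x y] positiveD(2)[of R x y] Q R(1)
        by (subst (1) y_def) (simp add: ri.diff_left ri.zero_right)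
      then show ?thesis by (simp add: ri_self y_def)
    qed
    then show "Q = R" by blast
  qed (use R in auto)
qed

lemma positive_series:
  assumes pos: "\<And>i. i \<in> I \<Longrightarrow> positive (P i)" and sm: "\<And>f. (\<lambda>i. P i f) summable_on I"
  shows "positive (\<lambda>f. \<Sum>\<^sub>\<infinity>i\<in>I. P i f)"
    and "((\<lambda>i. ri (P i f) f) has_sum ri (\<Sum>\<^sub>\<infinity>i\<in>I. P i f) f) I"
proof -
  define S where "S f = (\<Sum>\<^sub>\<infinity>i\<in>I. P i f)" for f
  have S: "((\<lambda>i. P i f) has_sum S f) I" for f
    unfolding S_def using sm by (rule has_sum_infsum)
  have riS: "((\<lambda>i. ri (P i f) g) has_sum ri (S f) g) I" for f g
    by (rule has_sum_bounded_linear[OF ri.bounded_linear_left S])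
  have sym: "ri (S f) g = ri f (S g)" for f g
  proof (rule has_sum_unique[OF riS])
    show "((\<lambda>i. ri (P i f) g) has_sum ri f (S g)) I"
      using has_sum_bounded_linear[OF ri.bounded_linear_right S, of f g]
      by (rule has_sum_cong[THEN iffD1, rotated]) (simp add: positiveD(2)[OF pos])
  qed
  \<comment> \<open>Linearity is read off from symmetry: \<open>ri (S f) z = ri f (S z)\<close> is
    linear in \<open>f\<close> for every \<open>z\<close>.\<close>
  have "linear S"
    by (rule linearI; rule ri_eqI)
      (simp_all add: sym ri.add_left ri.scaleR_left)
  then have "bounded_linear S" by (rule hellinger_toeplitz) (rule sym)
  moreover have "0 \<le> ri (S f) f" for f
    by (rule has_sum_nonneg[OF riS]) (rule positiveD(3)[OF pos])
  ultimately show "positive (\<lambda>f. \<Sum>\<^sub>\<infinity>i\<in>I. P i f)"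
    unfolding positive_def S_def[symmetric] using sym by blast
  show "((\<lambda>i. ri (P i f) f) has_sum ri (\<Sum>\<^sub>\<infinity>i\<in>I. P i f) f) I"
    using riS unfolding S_def .
qed

end

section \<open>Real parts of scalars\<close>

lemma hconj_of_real [simp]: "hconj (of_real r :: 'k::hilbert_scalar) = of_real r"
  by (simp add: of_real_def hconj_scaleR_one)

text \<open>Here \<open>z\<^sup>2 = z * hconj z\<close> is the square of the real number
  \<open>norm z\<close>, so \<open>z\<close> is that number or its negative.\<close>

lemma hconj_eq_self_imp_real:
  fixes z :: "'k::hilbert_scalar"
  assumes "hconj z = z"
  shows "\<exists>r. z = of_real r"
proof -
  have "z\<^sup>2 = (of_real (norm z))\<^sup>2"
    using mult_hconj[of z] assms by (simp add: power2_eq_square of_real_def)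
  then have "z = of_real (norm z) \<or> z = of_real (- norm z)"
    by (simp add: power2_eq_iff)
  then show ?thesis by blast
qed

text \<open>The usual real part, expressed through conjugation so that it makes sense for every
  scalar field of the class; \<open>z + hconj z\<close> is fixed by \<open>hconj\<close> and
  therefore real.\<close>

definition scalar_re :: "'k::hilbert_scalar \<Rightarrow> real"
  where "scalar_re z = (THE r. z + hconj z = of_real (2 * r))"

lemma scalar_re_eqI: "z + hconj z = of_real (2 * r) \<Longrightarrow> scalar_re z = r"
  unfolding scalar_re_def by (rule the_equality) (simp_all del: of_real_mult)

lemma of_real_scalar_re: "of_real (2 * scalar_re z) = z + hconj (z :: 'k::hilbert_scalar)"
proof -
  have "hconj (z + hconj z) = z + hconj z"
    by (simp add: hconj_add hconj_hconj add.commute)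
  from hconj_eq_self_imp_real[OF this] obtain r where "z + hconj z = of_real (2 * (r / 2))" by auto
  then show ?thesis using scalar_re_eqI by metis
qed

lemma scalar_re_add: "scalar_re (z + w) = scalar_re z + scalar_re (w :: 'k::hilbert_scalar)"
  by (rule scalar_re_eqI, unfold distrib_left of_real_add of_real_scalar_re hconj_add) simp

lemma scalar_re_of_real_mult: "scalar_re (of_real r * z) = r * scalar_re (z :: 'k::hilbert_scalar)"
proof (rule scalar_re_eqI)
  have "of_real (2 * (r * scalar_re z)) = of_real r * (of_real (2 * scalar_re z) :: 'k)" by simp
  then show "of_real r * z + hconj (of_real r * z) = of_real (2 * (r * scalar_re z))"
    by (simp add: of_real_scalar_re hconj_mult distrib_left del: of_real_mult)
qed

lemma scalar_re_of_real [simp]: "scalar_re (of_real r :: 'k::hilbert_scalar) = r"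
  by (rule scalar_re_eqI) simp

lemma scalar_re_hconj [simp]: "scalar_re (hconj z) = scalar_re (z :: 'k::hilbert_scalar)"
  by (rule scalar_re_eqI, unfold of_real_scalar_re) (simp add: hconj_hconj add.commute)

lemma of_real_scalar_re_self:
  assumes "hconj z = (z :: 'k::hilbert_scalar)"
  shows "of_real (scalar_re z) = z"
  using hconj_eq_self_imp_real[OF assms] by auto

text \<open>The multiplier \<open>a = hconj (z - w)\<close> exposes
  \<open>(norm (z - w))\<^sup>2\<close>. This lifts identities between real parts to identities
  between scalars.\<close>

lemma scalar_eqI:
  fixes z w :: "'k::hilbert_scalar"
  assumes "\<And>a. scalar_re (a * z) = scalar_re (a * w)"
  shows "z = w"
proof -
  have "scalar_re (hconj (z - w) * z) = scalar_re (hconj (z - w) * (z - w)) + scalar_re (hconj (z - w) * w)"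
    by (simp add: scalar_re_add[symmetric] distrib_left[symmetric])
  moreover have "hconj (z - w) * (z - w) = of_real ((norm (z - w))\<^sup>2)"
    using mult_hconj[of "z - w"] by (simp add: mult.commute of_real_def)
  ultimately have "(norm (z - w))\<^sup>2 = 0" using assms by (simp del: of_real_power)
  then show ?thesis by simp
qed

lemma nonneg_scalarD:
  assumes "nonneg_scalar (z :: 'k::hilbert_scalar)"
  shows "0 \<le> scalar_re z" "scalar_re z = norm z" "of_real (scalar_re z) = z"
  using assms unfolding nonneg_scalar_def by auto

section \<open>Operators on a Hilbert space\<close>

context hilbert_space
begin

section \<open>The underlying real inner product\<close>

definition rip :: "'h \<Rightarrow> 'h \<Rightarrow> real"
  where "rip x y = scalar_re (ip x y)"

sublocale rh: real_hilbert rip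
proof
  show "rip (r *\<^sub>R x) z = r * rip x z" for r x z
    by (simp add: rip_def scale_of_real[symmetric] ip_scale_left scalar_re_of_real_mult)
  show "rip x y = rip y x" for x y
    unfolding rip_def using ip_commute[of x y] by simp
qed (simp_all only: rip_def ip_add_left scalar_re_add ip_self scalar_re_of_real)

lemma ip_scale_right: "ip x (scl a y) = hconj a * ip x y"
  using ip_commute[of x "scl a y"] ip_commute[of x y] by (simp add: ip_scale_left hconj_mult)

lemma norm_scl: "norm (scl a x) = norm a * norm x"
proof -
  have "of_real ((norm (scl a x))\<^sup>2) = a * hconj a * of_real ((norm x)\<^sup>2)"
    unfolding ip_self[symmetric] by (simp add: ip_scale_left ip_scale_right)
  also have "\<dots> = of_real ((norm a * norm x)\<^sup>2)"
    unfolding mult_hconj by (simp add: of_real_def power_mult_distrib)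
  finally have "(norm (scl a x))\<^sup>2 = (norm a * norm x)\<^sup>2" by (simp only: of_real_eq_iff)
  then show ?thesis by (rule power2_eq_imp_eq) auto
qed

lemma bounded_linear_scl: "bounded_linear (scl a)"
  by (rule bounded_linear_intro[of _ "norm a"])
    (simp_all add: scale_right_distrib norm_scl mult.commute scale_left_commute
      flip: scale_of_real)

lemma ip_eqI_rip:
  assumes "\<And>a. rip (scl a x) y = rip (scl a z) w"
  shows "ip x y = ip z w"
  by (rule scalar_eqI) (use assms in \<open>simp add: rip_def ip_scale_left\<close>)

lemma bounded_op_iff:
  "bounded_op scl T \<longleftrightarrow> bounded_linear T \<and> (\<forall>a x. T (scl a x) = scl a (T x))"
proof
  assume *: "bounded_op scl T"
  then obtain c where "Vector_Spaces.linear scl scl T" and c: "\<And>x. norm (T x) \<le> c * norm x"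
    unfolding bounded_op_def by blast
  then have T: "T (x + y) = T x + T y" "T (scl a x) = scl a (T x)" for a x y
    unfolding Vector_Spaces.linear_iff by auto
  moreover have "bounded_linear T"
    by (rule bounded_linear_intro[of _ c])
      (simp_all add: T c mult.commute[of _ c] flip: scale_of_real)
  ultimately show "bounded_linear T \<and> (\<forall>a x. T (scl a x) = scl a (T x))" by blast
next
  assume *: "bounded_linear T \<and> (\<forall>a x. T (scl a x) = scl a (T x))"
  then interpret T: bounded_linear T by blast
  have "\<exists>c. \<forall>x. norm (T x) \<le> c * norm x"
    using T.bounded by (metis mult.commute)
  then show "bounded_op scl T"
    unfolding bounded_op_def Vector_Spaces.linear_iff
    using * T.add vector_space_axioms by blast
qed

text \<open>The real Riesz theorem represents the real part; testing it on all
  \<open>scl a x\<close> recovers the full scalar value.\<close>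

lemma riesz_scalar:
  assumes add: "\<And>x y. \<phi> (x + y) = \<phi> x + \<phi> y"
    and scale: "\<And>a x. \<phi> (scl a x) = a * \<phi> x"
    and bound: "\<And>x. \<bar>scalar_re (\<phi> x)\<bar> \<le> c * norm x"
  shows "\<exists>z. \<forall>x. \<phi> x = ip x z"
proof -
  have "bounded_linear (\<lambda>x. scalar_re (\<phi> x))"
    by (rule bounded_linear_intro[of _ c])
      (use bound in \<open>simp_all add: add scale scalar_re_add scalar_re_of_real_mult mult.commute
        flip: scale_of_real\<close>)
  then obtain z where z: "\<And>x. scalar_re (\<phi> x) = rip x z"
    using rh.riesz_representation by blast
  have "\<phi> x = ip x z" for x
  proof (rule scalar_eqI)
    show "scalar_re (a * \<phi> x) = scalar_re (a * ip x z)" for a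
      using z[of "scl a x"] by (simp add: scale rip_def ip_scale_left)
  qed
  then show ?thesis by blast
qed

section \<open>Adjoints, positivity and square roots for the scalar-valued inner product\<close>

lemma ip_right_eqI: "(\<And>f. ip f x = ip f y) \<Longrightarrow> x = y"
  by (rule rh.ri_eqI) (metis rip_def rh.ri_commute)

lemma hadjoint_eqI:
  assumes "\<And>f. ip' (T f) y = ip f x"
  shows "hadjoint ip ip' T y = x"
  unfolding hadjoint_def
  by (rule the_equality) (use assms ip_right_eqI in auto)

lemma hadjoint_bounded_op:
  assumes "bounded_op scl T"
  shows "ip f (hadjoint ip ip T y) = ip (T f) y"
proof -
  interpret T: bounded_linear T using assms by (simp add: bounded_op_iff)
  have scl: "T (scl a x) = scl a (T x)" for a x using assms by (simp add: bounded_op_iff)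
  obtain k where "k \<ge> 0" and k: "\<And>x. norm (T x) \<le> norm x * k" using T.nonneg_bounded by blast
  have "\<exists>z. \<forall>x. ip (T x) y = ip x z"
  proof (rule riesz_scalar)
    show "\<bar>scalar_re (ip (T x) y)\<bar> \<le> (k * norm y) * norm x" for x
      using rh.ri_Cauchy_Schwarz[of "T x" y] mult_right_mono[OF k[of x], of "norm y"]
      by (simp add: rip_def mult_ac)
  qed (simp_all add: T.add scl ip_add_left ip_scale_left)
  then obtain z where z: "\<And>x. ip (T x) y = ip x z" by blast
  have "hadjoint ip ip T y = z" by (rule hadjoint_eqI) (rule z)
  then show ?thesis using z by simp
qed

text \<open>Homogeneity over \<open>scl\<close> upgrades symmetry for \<open>rip\<close> to symmetry
  for \<open>ip\<close>. Then \<open>ip (T f) f\<close> is its own conjugate, hence real, and its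
  sign is that of \<open>rip (T f) f\<close>.\<close>

lemma positive_op_iff:
  "positive_op scl ip T \<longleftrightarrow> rh.positive T \<and> (\<forall>a x. T (scl a x) = scl a (T x))"
proof
  assume *: "positive_op scl ip T"
  then have "bounded_op scl T" and adj: "hadjoint ip ip T = T"
    and nonneg: "nonneg_scalar (ip (T f) f)" for f
    unfolding positive_op_def by auto
  then show "rh.positive T \<and> (\<forall>a x. T (scl a x) = scl a (T x))"
    using hadjoint_bounded_op[of T] nonneg_scalarD(1)[OF nonneg]
    unfolding rh.positive_def bounded_op_iff rip_def by simp
next
  assume *: "rh.positive T \<and> (\<forall>a x. T (scl a x) = scl a (T x))"
  then have T: "rh.positive T" "\<And>a x. T (scl a x) = scl a (T x)" by auto
  have sym: "ip (T f) g = ip f (T g)" for f g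
    by (rule ip_eqI_rip) (simp add: rh.positiveD(2)[OF T(1)] flip: T(2))
  have "hadjoint ip ip T = T"
    by (rule ext, rule hadjoint_eqI) (rule sym)
  moreover have "nonneg_scalar (ip (T f) f)" for f
  proof -
    have "hconj (ip (T f) f) = ip (T f) f"
      using ip_commute[of f "T f"] sym[of f f] by simp
    then have "ip (T f) f = of_real (rip (T f) f)"
      using of_real_scalar_re_self unfolding rip_def by metis
    then show ?thesis unfolding nonneg_scalar_def using rh.positiveD(3)[OF T(1)] by blast
  qed
  ultimately show "positive_op scl ip T"
    unfolding positive_op_def bounded_op_iff using T rh.positiveD(1) by blast
qed

text \<open>Each \<open>scl a\<close> commutes with \<open>T\<close>, hence with the real square
  root, which is therefore scalar-linear. Uniqueness in the real theory settles the
  \<open>THE\<close>.\<close>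

lemma op_sqrt:
  assumes "positive_op scl ip T"
  shows "positive_op scl ip (op_sqrt scl ip T)" and "op_sqrt scl ip T (op_sqrt scl ip T x) = T x"
proof -
  have T: "rh.positive T" "\<And>a x. T (scl a x) = scl a (T x)"
    using assms by (auto simp: positive_op_iff)
  obtain Q where Q: "rh.positive Q" "\<And>x. Q (Q x) = T x"
    and comm: "\<And>B x. bounded_linear B \<Longrightarrow> (\<And>x. B (T x) = T (B x)) \<Longrightarrow> B (Q x) = Q (B x)"
    using rh.positive_sqrt_exists[OF T(1)] by metis
  have "Q (scl a x) = scl a (Q x)" for a x
    using comm[OF bounded_linear_scl[of a], of x] T(2) by simp
  then have "positive_op scl ip Q \<and> Q \<circ> Q = T"
    using Q by (auto simp: positive_op_iff)
  moreover have "Q' = Q" if "positive_op scl ip Q' \<and> Q' \<circ> Q' = T" for Q'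
    using that Q rh.positive_sqrt_unique[OF T(1)] by (auto simp: positive_op_iff fun_eq_iff)
  ultimately have "positive_op scl ip (op_sqrt scl ip T) \<and> op_sqrt scl ip T \<circ> op_sqrt scl ip T = T"
    unfolding op_sqrt_def by (rule theI)
  then show "positive_op scl ip (op_sqrt scl ip T)" "op_sqrt scl ip T (op_sqrt scl ip T x) = T x"
    by (auto simp: fun_eq_iff)
qed

lemma norm_op_sqrt:
  assumes "positive_op scl ip T"
  shows "(norm (op_sqrt scl ip T f))\<^sup>2 = rip (T f) f"
proof -
  have "rh.positive (op_sqrt scl ip T)" using op_sqrt(1)[OF assms] by (simp add: positive_op_iff)
  then show ?thesis
    using rh.positiveD(2)[of _ "op_sqrt scl ip T f" f] op_sqrt(2)[OF assms]
    by (metis rh.ri_self)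
qed

section \<open>The synthesis map and its relation to the frame inequality\<close>

lemma synthesis_well_defined_iff:
  assumes "\<And>i. i \<in> I \<Longrightarrow> positive_op scl ip (P i)"
  shows "synthesis_well_defined scl ip I P \<longleftrightarrow> (\<forall>f. (\<lambda>i. P i f) summable_on I)"
proof
  assume sm: "\<forall>f. (\<lambda>i. P i f) summable_on I"
  have pos: "i \<in> I \<Longrightarrow> rh.positive (P i)" for i using assms by (simp add: positive_op_iff)
  show "synthesis_well_defined scl ip I P"
    unfolding synthesis_well_defined_def
  proof (intro conjI allI impI sm[rule_format])
    fix f
    \<comment> \<open>These terms are the squared norms of the entries of the family, by
      \<open>norm_op_sqrt\<close>.\<close>
    have "(\<lambda>i. rip (P i f) f) summable_on I"
      using rh.positive_series(2)[OF pos sm[rule_format]] by (rule has_sum_imp_summable)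
    then have "(\<lambda>i. (norm (op_sqrt scl ip (P i) f))\<^sup>2) summable_on I"
      by (rule summable_on_cong[THEN iffD1, rotated]) (simp add: norm_op_sqrt assms)
    then show "sqrt_family scl ip I P f \<in> ell2 I"
      unfolding ell2_def sqrt_family_def
      by (auto intro: summable_on_cong[THEN iffD1, rotated])
  next
    fix f f' assume eq: "sqrt_family scl ip I P f = sqrt_family scl ip I P f'"
    show "(\<Sum>\<^sub>\<infinity>i\<in>I. P i f) = (\<Sum>\<^sub>\<infinity>i\<in>I. P i f')"
    proof (rule infsum_cong)
      fix i assume "i \<in> I"
      then have "op_sqrt scl ip (P i) f = op_sqrt scl ip (P i) f'"
        using fun_cong[OF eq, of i] by (simp add: sqrt_family_def)
      \<comment> \<open>Applying the square root once more to the common entry gives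
        \<open>P i\<close> on both sides, so already the individual terms agree.\<close>
      then show "P i f = P i f'" using op_sqrt(2)[OF assms[OF \<open>i \<in> I\<close>]] by metis
    qed
  qed
qed (simp add: synthesis_well_defined_def)

lemma synthesis_sqrt_family:
  assumes "synthesis_well_defined scl ip I P"
  shows "synthesis scl ip I P (sqrt_family scl ip I P f) = (\<Sum>\<^sub>\<infinity>i\<in>I. P i f)"
proof -
  let ?g = "SOME g. sqrt_family scl ip I P g = sqrt_family scl ip I P f"
  have "sqrt_family scl ip I P ?g = sqrt_family scl ip I P f" by (rule someI) (rule refl)
  then show ?thesis using assms unfolding synthesis_def synthesis_well_defined_def by blast
qed

lemma synthesis_linear:
  assumes pos: "\<And>i. i \<in> I \<Longrightarrow> positive_op scl ip (P i)"
    and wd: "synthesis_well_defined scl ip I P"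
  shows "linear_on_families scl I (sqrt_families scl ip I P) (synthesis scl ip I P)"
proof -
  let ?F = "sqrt_family scl ip I P" and ?K = "sqrt_families scl ip I P"
  let ?T = "synthesis scl ip I P"
  have sm: "(\<lambda>i. P i f) summable_on I" for f using wd by (simp add: synthesis_well_defined_def)
  have P: "bounded_linear (P i)" "P i (scl a f) = scl a (P i f)" if "i \<in> I" for i a f
    using pos[OF that] by (auto simp: positive_op_iff rh.positive_def)
  have Q: "bounded_linear (op_sqrt scl ip (P i))"
    "op_sqrt scl ip (P i) (scl a f) = scl a (op_sqrt scl ip (P i) f)" if "i \<in> I" for i a f
    using op_sqrt(1)[OF pos[OF that]] by (auto simp: positive_op_iff rh.positive_def)
  have F_add: "(\<lambda>i\<in>I. ?F f i + ?F g i) = ?F (f + g)" for f g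
    by (rule ext) (simp add: sqrt_family_def linear_add[OF bounded_linear.linear[OF Q(1)]])
  have F_scl: "(\<lambda>i\<in>I. scl a (?F f i)) = ?F (scl a f)" for a f
    by (rule ext) (simp add: sqrt_family_def Q(2))
  have T_add: "?T (?F (f + g)) = ?T (?F f) + ?T (?F g)" for f g
  proof -
    have "(\<Sum>\<^sub>\<infinity>i\<in>I. P i (f + g)) = (\<Sum>\<^sub>\<infinity>i\<in>I. P i f + P i g)"
      by (rule infsum_cong) (simp add: linear_add[OF bounded_linear.linear[OF P(1)]])
    then show ?thesis unfolding synthesis_sqrt_family[OF wd] by (simp add: infsum_add sm)
  qed
  have T_scl: "?T (?F (scl a f)) = scl a (?T (?F f))" for a f
  proof -
    have "((\<lambda>i. scl a (P i f)) has_sum scl a (\<Sum>\<^sub>\<infinity>i\<in>I. P i f)) I"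
      by (rule has_sum_bounded_linear[OF bounded_linear_scl has_sum_infsum[OF sm]])
    then have "(\<Sum>\<^sub>\<infinity>i\<in>I. scl a (P i f)) = scl a (\<Sum>\<^sub>\<infinity>i\<in>I. P i f)" by (rule infsumI)
    moreover have "(\<Sum>\<^sub>\<infinity>i\<in>I. P i (scl a f)) = (\<Sum>\<^sub>\<infinity>i\<in>I. scl a (P i f))"
      by (rule infsum_cong) (simp add: P(2))
    ultimately show ?thesis unfolding synthesis_sqrt_family[OF wd] by simp
  qed
  show ?thesis
    unfolding linear_on_families_def sqrt_families_def
    by (auto simp: F_add F_scl T_add T_scl)
qed

lemma frame_iff_synthesis_surj:
  assumes pos: "\<And>i. i \<in> I \<Longrightarrow> positive_op scl ip (P i)"
  shows "(\<exists>A B. 0 < A \<and> A \<le> B \<and> (\<forall>f. \<exists>s. ((\<lambda>i. rip (P i f) f) has_sum s) I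
      \<and> A * (norm f)\<^sup>2 \<le> s \<and> s \<le> B * (norm f)\<^sup>2)) \<longleftrightarrow>
    synthesis_well_defined scl ip I P \<and>
    synthesis scl ip I P ` sqrt_families scl ip I P = UNIV" (is "?L \<longleftrightarrow> ?R")
proof -
  have rpos: "i \<in> I \<Longrightarrow> rh.positive (P i)" for i using pos by (simp add: positive_op_iff)
  define S where "S f = (\<Sum>\<^sub>\<infinity>i\<in>I. P i f)" for f
  \<comment> \<open>The set of families is the range of \<open>sqrt_family\<close>, and the
    synthesis map composed with \<open>sqrt_family\<close> is \<open>S\<close>; so its image is the
    range of \<open>S\<close>.\<close>
  have R_iff: "?R \<longleftrightarrow> (\<forall>f. (\<lambda>i. P i f) summable_on I) \<and> surj S"
    using synthesis_sqrt_family[of I P] synthesis_well_defined_iff[of I P, OF pos]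
    by (auto simp: sqrt_families_def image_image S_def cong: conj_cong)
  show ?thesis
    unfolding R_iff
  proof
    assume ?L
    then obtain A B where "0 < A" "A \<le> B"
      and frame: "\<And>f. \<exists>s. ((\<lambda>i. rip (P i f) f) has_sum s) I
        \<and> A * (norm f)\<^sup>2 \<le> s \<and> s \<le> B * (norm f)\<^sup>2" by blast
    have sm: "(\<lambda>i. P i f) summable_on I" for f
    proof (rule rh.positive_series_summable[of I P B, OF rpos])
      show "0 \<le> B" using \<open>0 < A\<close> \<open>A \<le> B\<close> by simp
      show "(\<lambda>i. rip (P i f) f) summable_on I"
        using frame by (auto simp: summable_on_def)
      show "(\<Sum>i\<in>F. rip (P i g) g) \<le> B * (norm g)\<^sup>2" if "finite F" "F \<subseteq> I" for F g
      proof -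
        obtain s where s: "((\<lambda>i. rip (P i g) g) has_sum s) I" "s \<le> B * (norm g)\<^sup>2"
          using frame by blast
        have "(\<Sum>i\<in>F. rip (P i g) g) \<le> s"
          using that rh.positiveD(3) rpos by (intro finite_sum_le_has_sum[OF s(1)]) auto
        then show ?thesis using s(2) by simp
      qed
    qed
    have "rh.positive S" unfolding S_def using rh.positive_series(1) rpos sm by blast
    have "A * (norm f)\<^sup>2 \<le> rip (S f) f" for f
      using frame[of f] rh.positive_series(2)[OF rpos sm, of f] has_sum_unique
      unfolding S_def by blast
    then have "surj S" by (rule rh.coercive_surj[OF rh.positiveD(1)[OF \<open>rh.positive S\<close>] \<open>0 < A\<close>])
    then show "(\<forall>f. (\<lambda>i. P i f) summable_on I) \<and> surj S" using sm by blast
  next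
    assume *: "(\<forall>f. (\<lambda>i. P i f) summable_on I) \<and> surj S"
    then have sm: "(\<lambda>i. P i f) summable_on I" for f by blast
    have "rh.positive S" unfolding S_def using rh.positive_series(1) rpos sm by blast
    then interpret S: bounded_linear S by (rule rh.positiveD)
    obtain A where "A > 0" and A: "\<And>f. A * (norm f)\<^sup>2 \<le> rip (S f) f"
      using rh.positive_surj_imp_coercive[OF \<open>rh.positive S\<close>] * by blast
    obtain k where k: "\<And>f. norm (S f) \<le> norm f * k" using S.bounded by blast
    \<comment> \<open>The maximum with \<open>A\<close> secures that the upper frame bound is at
      least the lower one.\<close>
    have "rip (S f) f \<le> max A k * (norm f)\<^sup>2" for f
    proof -
      have "rip (S f) f \<le> norm (S f) * norm f" using rh.ri_Cauchy_Schwarz[of "S f" f] by simp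
      also have "\<dots> \<le> norm f * k * norm f" by (rule mult_right_mono[OF k norm_ge_zero])
      also have "\<dots> = k * (norm f)\<^sup>2" by (simp add: power2_eq_square)
      also have "\<dots> \<le> max A k * (norm f)\<^sup>2" by (rule mult_right_mono) auto
      finally show ?thesis .
    qed
    moreover have "((\<lambda>i. rip (P i f) f) has_sum rip (S f) f) I" for f
      unfolding S_def using rh.positive_series(2) rpos sm by blast
    ultimately show ?L
      using \<open>A > 0\<close> A by (intro exI[of _ A] exI[of _ "max A k"]) (auto intro!: exI)
  qed
qed

text \<open>The inner product of \<open>M\<close> is pulled back along \<open>T\<close> to a
  semidefinite form \<open>b\<close> on \<open>'h\<close>, whose Cauchy--Schwarz inequality gives
  the bound that Riesz requires. Evaluating the adjoint at \<open>T g\<close> keeps both arguments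
  in the range of \<open>T\<close>, and controlled operators apply it only to such vectors.\<close>

lemma hadjoint_bounded_op_into:
  assumes "hilbert_struct M" and "bounded_op_into scl M T"
  shows "ip f (hadjoint ip (hinner M) T (T g)) = hinner M (T f) (T g)"
proof -
  interpret M: hilbert_struct M by fact
  have carr: "T x \<in> carrier M"
    and add: "T (x + y) = T x \<oplus>\<^bsub>M\<^esub> T y"
    and smult: "T (scl a x) = a \<odot>\<^bsub>M\<^esub> T x" for x y a
    using assms(2) by (auto simp: bounded_op_into_def)
  obtain c where c: "\<And>x. hnorm M (T x) \<le> c * norm x"
    using assms(2) by (auto simp: bounded_op_into_def)
  define b where "b x y = scalar_re (hinner M (T x) (T y))" for x y
  have b_nonneg: "0 \<le> b x x" for x
    unfolding b_def by (rule nonneg_scalarD(1)[OF M.hinner_nonneg[OF carr]])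
  have b_CS: "(b x y)\<^sup>2 \<le> b x x * b y y" for x y
  proof (rule psd_form_Cauchy_Schwarz)
    show "b (x + y) z = b x z + b y z" for x y z
      by (simp add: b_def add M.hinner_add_left carr scalar_re_add)
    show "b (r *\<^sub>R x) z = r * b x z" for r x z
      by (simp add: b_def smult M.hinner_smult_left carr scalar_re_of_real_mult
          flip: scale_of_real)
    show "b x y = b y x" for x y
      unfolding b_def using M.hinner_commute[OF carr carr, of x y] by simp
  qed (rule b_nonneg)
  have b_bound: "b x x \<le> (c * norm x)\<^sup>2" for x
  proof -
    have "b x x = (hnorm M (T x))\<^sup>2"
      unfolding b_def hnorm_def nonneg_scalarD(2)[OF M.hinner_nonneg[OF carr]] by simp
    also have "\<dots> \<le> (c * norm x)\<^sup>2"
      by (rule power_mono[OF c]) (simp add: hnorm_def)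
    finally show ?thesis .
  qed
  have "\<exists>z. \<forall>x. hinner M (T x) (T g) = ip x z"
  proof (rule riesz_scalar)
    fix x
    have "(b x g)\<^sup>2 \<le> (c * norm x)\<^sup>2 * b g g"
      using b_CS[of x g] mult_right_mono[OF b_bound b_nonneg] by (rule order_trans)
    also have "\<dots> = (\<bar>c\<bar> * sqrt (b g g) * norm x)\<^sup>2"
      by (simp add: power_mult_distrib b_nonneg)
    finally have "\<bar>b x g\<bar> \<le> \<bar>\<bar>c\<bar> * sqrt (b g g) * norm x\<bar>"
      by (simp only: abs_le_square_iff)
    then show "\<bar>scalar_re (hinner M (T x) (T g))\<bar> \<le> \<bar>c\<bar> * sqrt (b g g) * norm x"
      by (simp add: b_def[of x g] abs_mult b_nonneg)
  qed (simp_all add: add smult carr M.hinner_add_left M.hinner_smult_left)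
  then obtain z where z: "\<And>x. hinner M (T x) (T g) = ip x z" by blast
  have "hadjoint ip (hinner M) T (T g) = z" by (rule hadjoint_eqI) (rule z)
  then show ?thesis using z by simp
qed

text \<open>Both adjoints are moved across in \<open>ip f (P i f)\<close>; the conjugations put the
  arguments in the order of the frame inequality.\<close>

lemma ip_controlled_op:
  assumes "hilbert_struct (Hs i)" and "bounded_op_into scl (Hs i) (\<Lambda> i)" and "bounded_op scl C"
  shows "ip (controlled_op ip Hs C C' \<Lambda> i f) f = hinner (Hs i) (\<Lambda> i (C' f)) (\<Lambda> i (C f))"
proof -
  interpret M: hilbert_struct "Hs i" by fact
  have "\<Lambda> i x \<in> carrier (Hs i)" for x using assms(2) by (auto simp: bounded_op_into_def)
  then have "hinner (Hs i) (\<Lambda> i (C' f)) (\<Lambda> i (C f)) = hconj (hinner (Hs i) (\<Lambda> i (C f)) (\<Lambda> i (C' f)))"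
    by (intro M.hinner_commute)
  also have "\<dots> = hconj (ip f (controlled_op ip Hs C C' \<Lambda> i f))"
    by (simp add: controlled_op_def hadjoint_bounded_op[OF assms(3)]
        hadjoint_bounded_op_into[OF assms(1,2)])
  also have "\<dots> = ip (controlled_op ip Hs C C' \<Lambda> i f) f" by (rule ip_commute[symmetric])
  finally show ?thesis ..
qed

end

theorem theorem2p5:
  fixes scl :: "'k::hilbert_scalar \<Rightarrow> 'h::banach \<Rightarrow> 'h"
    and ip :: "'h \<Rightarrow> 'h \<Rightarrow> 'k"
    and I :: "'i set"
    and Hs :: "'i \<Rightarrow> ('k, 'g) inner_struct"
    and C C' :: "'h \<Rightarrow> 'h"
    and \<Lambda> :: "'i \<Rightarrow> 'h \<Rightarrow> 'g"
  defines "P \<equiv> controlled_op ip Hs C C' \<Lambda>"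
  defines "K \<equiv> sqrt_families scl ip I P"
  defines "T \<equiv> synthesis scl ip I P"
  assumes "hilbert_space scl ip"
    and "separable_space (euclidean :: 'h topology)"
    and "\<And>i. i \<in> I \<Longrightarrow> hilbert_struct (Hs i)"
    and "boundedly_invertible scl C"
    and "boundedly_invertible scl C'"
    and "\<And>i. i \<in> I \<Longrightarrow> bounded_op_into scl (Hs i) (\<Lambda> i)"
    and "\<And>i. i \<in> I \<Longrightarrow> positive_op scl ip (P i)"
  shows "controlled_g_frame I Hs C C' \<Lambda> \<longleftrightarrow>
    synthesis_well_defined scl ip I P \<and> linear_on_families scl I K T \<and> T ` K = UNIV"
proof -
  interpret hilbert_space scl ip by fact
  note pos = assms(10)
  have "bounded_op scl C" using assms(7) by (simp add: boundedly_invertible_def)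
  \<comment> \<open>Positivity of \<open>P i\<close> makes \<open>ip (P i f) f\<close> real, so the
    scalar-valued frame series is the image under \<open>of_real\<close> of a real series.\<close>
  have term_eq: "hinner (Hs i) (\<Lambda> i (C' f)) (\<Lambda> i (C f)) = of_real (rip (P i f) f)" if "i \<in> I" for i f
  proof -
    have "ip (P i f) f = of_real (rip (P i f) f)"
      using pos[OF that] nonneg_scalarD(3) unfolding positive_op_def rip_def by metis
    then show ?thesis
      using ip_controlled_op[of Hs i \<Lambda> C C' f, OF assms(6)[OF that] assms(9)[OF that]
          \<open>bounded_op scl C\<close>]
      unfolding P_def by simp
  qed
  have "((\<lambda>i. hinner (Hs i) (\<Lambda> i (C' f)) (\<Lambda> i (C f))) has_sum of_real s) I \<longleftrightarrow>
      ((\<lambda>i. rip (P i f) f) has_sum s) I" for f s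
    by (subst has_sum_cong[OF term_eq]) (simp_all only: has_sum_of_real_iff)
  then have "controlled_g_frame I Hs C C' \<Lambda> \<longleftrightarrow> synthesis_well_defined scl ip I P \<and> T ` K = UNIV"
    unfolding controlled_g_frame_def K_def T_def using frame_iff_synthesis_surj[of I P, OF pos] by simp
  \<comment> \<open>The linearity conjunct follows from well-definedness by
    \<open>synthesis_linear\<close>.\<close>
  then show ?thesis
    using synthesis_linear[of I P, OF pos] unfolding K_def T_def by blast
qed

end
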